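(* Let $\hat\Sigma$ and $\tilde\rho$ be surrogates of $\Sigma$ and $\rho$ satisfying the Closeness Condition with positive functions $\zeta$ and $\epsilon_0$, and suppose that $$\|\Sigma_{S^c,S}\Sigma_{S,S}^{-1}\|_\infty=1-\gamma<1,\qquad \Lambda_{\min}(\Sigma_{S,S})=C_{\min}>0 .$$ Then, for $\lambda\le\min(\epsilon_0,4\epsilon_0/\gamma)$ and $\epsilon\le\min\left(\epsilon_1,\ \lambda/(\lambda\epsilon_2+\epsilon_3)\right)$, where $\epsilon_1,\epsilon_2,\epsilon_3$ are bounded positive constants depending on $\Sigma_{S,S}$, $\beta^*_S$, $\theta$ and $\sigma^2$, the following occurs with probability at least $1-\delta_1$, where $$\delta_1=p^2C\exp\left(-cns^{-2}\gamma^2\lambda^2\zeta^{-1}\right)+p^2C\exp\left(-cns^{-2}\epsilon^2\zeta^{-1}\right):$$ (a) There exists a unique minimizer $\hat\beta$ of the CoCoLasso objective $\frac12\beta'\tilde\Sigma\beta-\tilde\rho'\beta+\lambda\|\beta\|_1$ over $\beta\in\mathbb{R}^p$, and its support is a subset of the true support $S$. (b) $\|\hat\beta_S-\beta^*_S\|_\infty\le\kappa\lambda$, where $\kappa=4\|\Sigma_{S,S}^{-1}\|_\infty+C_{\min}^{-1/2}$. (c) If $|\beta^*_{\min}|\ge\kappa\lambda$, where $|\beta^*_{\min}|=\min_{j\in S}|\beta^*_j|$, then $\mathrm{sign}(\hat\beta_S)=\mathrm{sign}(\beta^*_S)$ (entrywise).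
   Context: Model. $X$ is a fixed (non-random) $n\times p$ matrix with normalized columns, $\frac1n\sum_{i=1}^n x_{ij}^2=1$ for $j=1,\dots,p$. $y=X\beta^*+w$, where $\beta^*\in\mathbb{R}^p$ has support $S=\{1,\dots,s\}$ (so $\beta^*_j\ne0$ iff $j\in S$), and $w=(w_1,\dots,w_n)'$ has i.i.d. mean-zero sub-Gaussian entries with parameter $\sigma^2$, the sub-Gaussian parameter of a random variable $U$ being the smallest $\tau^2$ with $\Pr(|U|>t)\le2\exp(-t^2/(2\tau^2))$ for all $t>0$. Set $\Sigma=\frac1nX'X$ and $\rho=\frac1nX'y$. Subscripts $S$, $S^c$ denote sub-vectors and blocks indexed by $S$ and its complement. For a matrix $K$, $\|K\|_\infty=\max_i\sum_j|k_{ij}|$, $\|K\|_{\max}=\max_{i,j}|k_{ij}|$, and $\Lambda_{\min}(K)$ is the smallest eigenvalue. Estimator. $\hat\Sigma$ (a random symmetric $p\times p$ matrix, not necessarily positive semi-definite) and $\tilde\rho$ (a random $p$-vector) are surrogates for $\Sigma,\rho$ built from data. Let $(K)_+=\arg\min_{K_1\ge0}\|K-K_1\|_{\max}$ (minimum over positive semi-definite matrices) and $\tilde\Sigma=(\hat\Sigma)_+$. The CoCoLasso estimate $\hat\beta$ with tuning parameter $\lambda>0$ minimizes $\frac12\beta'\tilde\Sigma\beta-\tilde\rho'\beta+\lambda\|\beta\|_1$ over $\beta\in\mathbb{R}^p$. Closeness Condition. The distribution of $\hat\Sigma$ and $\tilde\rho$ is identified by a set of parameters $\theta$. There exist universal constants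 $C,c$ and positive functions $\zeta,\epsilon_0$ depending on $\beta^*_S$, $\theta$ and $\sigma^2$ such that for every $\epsilon\le\epsilon_0$, $$\Pr(|\hat\Sigma_{ij}-\Sigma_{ij}|\ge\epsilon)\le C\exp(-cn\epsilon^2\zeta^{-1})\ \ (i,j=1,\dots,p),$$ $$\Pr(|\tilde\rho_j-\rho_j|\ge\epsilon)\le C\exp(-cns^{-2}\epsilon^2\zeta^{-1})\ \ (j=1,\dots,p).$$ Constants. $C,c$ denote generic positive universal constants whose values vary from expression to expression.
   Formalization: The constants ε₁, ε₂, ε₃ are allowed to depend also on γ (besides Σ_SS, β*_S, θ, σ²); with constants independent of γ the claim fails, e.g. for exact surrogates with Gaussian noise, small ζ and small γ. *)

theory Defs
  imports
    "HOL-Probability.Probability"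
    "Jordan_Normal_Form.Char_Poly"
    "Jordan_Normal_Form.Gauss_Jordan_Elimination"
    "Jordan_Normal_Form.DL_Submatrix"
begin

(* In this file $ and \<bullet> are the operations on Jordan_Normal_Form vectors. *)
unbundle no vec_syntax and no inner_syntax

section \<open>Norms and smallest eigenvalue\<close>

(* The inserted 0 changes nothing for non-empty families of absolute values; it makes the norm of
   an empty matrix 0 (the block indexed by the complement of S is empty when S is everything). *)

definition mat_max_norm :: "real mat \<Rightarrow> real" where
  "mat_max_norm K = Max (insert 0 {\<bar>K $$ (i, j)\<bar> | i j. i < dim_row K \<and> j < dim_col K})"

definition mat_inf_norm :: "real mat \<Rightarrow> real" where
  "mat_inf_norm K = Max (insert 0 {\<Sum>j<dim_col K. \<bar>K $$ (i, j)\<bar> | i. i < dim_row K})"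

definition vec_inf_norm :: "real vec \<Rightarrow> real" where
  "vec_inf_norm v = Max (insert 0 {\<bar>v $ i\<bar> | i. i < dim_vec v})"

definition vec_l1_norm :: "real vec \<Rightarrow> real" where
  "vec_l1_norm v = (\<Sum>i<dim_vec v. \<bar>v $ i\<bar>)"

definition min_eigenvalue :: "real mat \<Rightarrow> real" where
  "min_eigenvalue K = Min {k. eigenvalue K k}"


section \<open>Sparse linear model with fixed design\<close>

(* For v = 0 the bound 2 * exp (- t^2 / (2 * v)) is read as its limit 0 (in HOL, division by 0
   would turn it into 2), so that 0 is the parameter of a variable that vanishes almost surely. *)
definition subgaussian_tail :: "'w measure \<Rightarrow> ('w \<Rightarrow> real) \<Rightarrow> real \<Rightarrow> bool" where
  "subgaussian_tail M U v \<longleftrightarrow> 0 \<le> v \<and>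
     (\<forall>t>0. measure M {\<omega> \<in> space M. t < \<bar>U \<omega>\<bar>} \<le> (if v = 0 then 0 else 2 * exp (- (t\<^sup>2 / (2 * v)))))"

definition subgaussian_parameter :: "'w measure \<Rightarrow> ('w \<Rightarrow> real) \<Rightarrow> real \<Rightarrow> bool" where
  "subgaussian_parameter M U v \<longleftrightarrow>
     subgaussian_tail M U v \<and> (\<forall>v'. subgaussian_tail M U v' \<longrightarrow> v \<le> v')"

(* Indices start at 0: the support S is {..<s}. *)
locale sparse_linear_model = prob_space M
  for M :: "'w measure" +
  fixes n p s :: nat
    and X :: "real mat"
    and \<beta> :: "real vec"
    and w :: "nat \<Rightarrow> 'w \<Rightarrow> real"
    and \<sigma>2 :: real
  assumes X_carrier: "X \<in> carrier_mat n p"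
    and normalized: "\<And>j. j < p \<Longrightarrow> (1 / real n) * (\<Sum>i<n. (X $$ (i, j))\<^sup>2) = 1"
    and \<beta>_carrier: "\<beta> \<in> carrier_vec p"
    and s_pos: "0 < s"
    and s_le_p: "s \<le> p"
    and support: "\<And>j. j < p \<Longrightarrow> \<beta> $ j \<noteq> 0 \<longleftrightarrow> j < s"
    and w_indep: "indep_vars (\<lambda>_. borel) w {..<n}"
    and w_ident: "\<And>i j. i < n \<Longrightarrow> j < n \<Longrightarrow> distr M borel (w i) = distr M borel (w j)"
    and w_integrable: "\<And>i. i < n \<Longrightarrow> integrable M (w i)"
    and w_mean: "\<And>i. i < n \<Longrightarrow> expectation (w i) = 0"
    and w_subgaussian: "\<And>i. i < n \<Longrightarrow> subgaussian_parameter M (w i) \<sigma>2"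

definition response :: "real mat \<Rightarrow> real vec \<Rightarrow> (nat \<Rightarrow> 'w \<Rightarrow> real) \<Rightarrow> 'w \<Rightarrow> real vec" where
  "response X \<beta> w \<omega> = X *\<^sub>v \<beta> + vec (dim_row X) (\<lambda>i. w i \<omega>)"

definition Sigma_mat :: "real mat \<Rightarrow> real mat" where
  "Sigma_mat X = (1 / real (dim_row X)) \<cdot>\<^sub>m (transpose_mat X * X)"

definition rho_vec :: "real mat \<Rightarrow> real vec \<Rightarrow> real vec" where
  "rho_vec X y = (1 / real (dim_row X)) \<cdot>\<^sub>v (transpose_mat X *\<^sub>v y)"


section \<open>Surrogates and the CoCoLasso\<close>

definition random_symmetric_mat :: "'w measure \<Rightarrow> nat \<Rightarrow> ('w \<Rightarrow> real mat) \<Rightarrow> bool" where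
  "random_symmetric_mat M p A \<longleftrightarrow>
     (\<forall>\<omega>\<in>space M. A \<omega> \<in> carrier_mat p p \<and> transpose_mat (A \<omega>) = A \<omega>) \<and>
     (\<forall>i<p. \<forall>j<p. (\<lambda>\<omega>. A \<omega> $$ (i, j)) \<in> borel_measurable M)"

definition random_vec :: "'w measure \<Rightarrow> nat \<Rightarrow> ('w \<Rightarrow> real vec) \<Rightarrow> bool" where
  "random_vec M p v \<longleftrightarrow>
     (\<forall>\<omega>\<in>space M. v \<omega> \<in> carrier_vec p) \<and>
     (\<forall>j<p. (\<lambda>\<omega>. v \<omega> $ j) \<in> borel_measurable M)"

(* z and e0 are the values of the functions zeta and epsilon_0 at the parameters in force. *)
definition closeness_condition ::
  "'w measure \<Rightarrow> nat \<Rightarrow> nat \<Rightarrow> nat \<Rightarrow> real mat \<Rightarrow> ('w \<Rightarrow> real vec) \<Rightarrow> ('w \<Rightarrow> real mat) \<Rightarrow> ('w \<Rightarrow> real vec)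
    \<Rightarrow> real \<Rightarrow> real \<Rightarrow> real \<Rightarrow> real \<Rightarrow> bool" where
  "closeness_condition M n p s \<Sigma> \<rho> \<Sigma>hat \<rho>til C c z e0 \<longleftrightarrow> 0 < z \<and> 0 < e0 \<and>
     (\<forall>\<epsilon>. 0 < \<epsilon> \<and> \<epsilon> \<le> e0 \<longrightarrow>
        (\<forall>i<p. \<forall>j<p. measure M {\<omega> \<in> space M. \<epsilon> \<le> \<bar>\<Sigma>hat \<omega> $$ (i, j) - \<Sigma> $$ (i, j)\<bar>}
             \<le> C * exp (- (c * real n * \<epsilon>\<^sup>2 / z))) \<and>
        (\<forall>j<p. measure M {\<omega> \<in> space M. \<epsilon> \<le> \<bar>\<rho>til \<omega> $ j - \<rho> \<omega> $ j\<bar>}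
             \<le> C * exp (- (c * real n * \<epsilon>\<^sup>2 / ((real s)\<^sup>2 * z)))))"

definition psd_mat :: "nat \<Rightarrow> real mat \<Rightarrow> bool" where
  "psd_mat p K \<longleftrightarrow> K \<in> carrier_mat p p \<and> transpose_mat K = K \<and>
     (\<forall>v\<in>carrier_vec p. 0 \<le> v \<bullet> (K *\<^sub>v v))"

(* A relation, since the minimizer in the max-norm need not be unique. *)
definition nearest_psd :: "nat \<Rightarrow> real mat \<Rightarrow> real mat \<Rightarrow> bool" where
  "nearest_psd p K K1 \<longleftrightarrow> is_arg_min (\<lambda>K1. mat_max_norm (K - K1)) (psd_mat p) K1"

definition cocolasso_objective :: "real mat \<Rightarrow> real vec \<Rightarrow> real \<Rightarrow> real vec \<Rightarrow> real" where
  "cocolasso_objective \<Sigma>til \<rho>til l b =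
     1 / 2 * (b \<bullet> (\<Sigma>til *\<^sub>v b)) - \<rho>til \<bullet> b + l * vec_l1_norm b"

definition cocolasso_minimizer :: "nat \<Rightarrow> real mat \<Rightarrow> real vec \<Rightarrow> real \<Rightarrow> real vec \<Rightarrow> bool" where
  "cocolasso_minimizer p \<Sigma>til \<rho>til l b \<longleftrightarrow>
     is_arg_min (cocolasso_objective \<Sigma>til \<rho>til l) (\<lambda>b. b \<in> carrier_vec p) b"

(* "P occurs with probability at least q": {\<omega>. P \<omega>} contains an event of probability at least q
   (it need not be measurable itself, as \<Sigma>til is an arbitrary selection of nearest matrices). *)
definition with_prob_at_least :: "'w measure \<Rightarrow> real \<Rightarrow> ('w \<Rightarrow> bool) \<Rightarrow> bool" where
  "with_prob_at_least M q P \<longleftrightarrow> (\<exists>E\<in>sets M. q \<le> measure M E \<and> (\<forall>\<omega>\<in>E. P \<omega>))"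

end

theory Submission
  imports Defs
begin

text \<open>
The proof separates a deterministic statement from a probability estimate.

Deterministically, suppose that every entry of \<open>\<Sigma>hat\<close> is within \<open>\<epsilon>\<close> of \<open>\<Sigma>\<close>, and every entry of \<open>\<rho>til\<close>
close to \<open>\<Sigma> \<beta>\<close>. The matrix \<open>\<Sigma>\<close> is positive semidefinite, hence it competes in the projection that
defines \<open>\<Sigma>til\<close>, and the entries of \<open>\<Sigma>til\<close> are within \<open>2 * \<epsilon>\<close> of those of \<open>\<Sigma>\<close>
(\<open>nearest_psd_entry_le\<close>). The CoCoLasso is then a convex problem close to a noiseless lasso, and
the primal-dual witness argument applies (\<open>lasso_support_recovery\<close>): the minimizer over vectors
supported on \<open>S\<close> is near \<open>\<beta>\<close> because the block of \<open>\<Sigma>til\<close> on \<open>S\<close> has a controlled inverse, and the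
irrepresentable condition makes its gradient strictly smaller than the tuning parameter outside \<open>S\<close>,
so it is the unique minimizer over all vectors. Both the lower bound on the quadratic form and the
control of the inverse come from the row sum norm of the inverse of the block of \<open>\<Sigma>\<close> on \<open>S\<close>; a
positive smallest eigenvalue provides this inverse.

Three kinds of error have to be small with high probability. The closeness condition bounds the
errors of \<open>\<Sigma>hat\<close> and of \<open>\<rho>til\<close> as an estimate of \<open>\<rho>\<close>. It is silent on the third, the correlation
of the columns of the design with the noise, by which \<open>\<rho>\<close> differs from \<open>\<Sigma> \<beta>\<close>: the tail of this error
is governed by \<open>\<sigma>2\<close>, whereas \<open>\<zeta>\<close> governs the probability that is to be reached. The two are
reconciled by \<open>\<epsilon>3\<close>, which may depend on \<open>\<sigma>2\<close> and on the value of \<open>\<zeta>\<close>. At the level \<open>\<epsilon> * T\<close> with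
\<open>T\<^sup>2\<close> proportional to \<open>\<sigma>2 / \<zeta>\<close> (with \<open>\<sigma>2\<close> enlarged by \<open>1\<close>) the noise obeys the same exponential bound as an
error \<open>\<epsilon>\<close> of \<open>\<Sigma>hat\<close> (\<open>noise_correlation_tail\<close>), and \<open>\<epsilon> * \<epsilon>3 \<le> l\<close> with \<open>\<epsilon>3\<close> proportional to
\<open>(1 + T + 2 * \<parallel>\<beta>\<parallel>\<^sub>1) / \<gamma>\<close> makes \<open>\<epsilon> * T\<close> small compared with \<open>\<gamma> * l\<close>. A union bound then charges all
failures to the summand of \<open>\<delta>1\<close> that contains \<open>\<epsilon>\<close> (\<open>cocolasso_good_event\<close>).

The noise estimate starts from the tail definition of a sub-Gaussian variable, which has to be
converted into a bound on the moment generating function (\<open>subgaussian_mgf\<close>) before Chernoff's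
inequality can be applied to the sum.
\<close>

section \<open>Quadratic forms and the lasso objective\<close>

definition quad_form :: "nat \<Rightarrow> (nat \<Rightarrow> nat \<Rightarrow> real) \<Rightarrow> (nat \<Rightarrow> real) \<Rightarrow> real" where
  "quad_form p A x = (\<Sum>i<p. x i * (\<Sum>j<p. A i j * x j))"

definition lasso :: "nat \<Rightarrow> (nat \<Rightarrow> nat \<Rightarrow> real) \<Rightarrow> (nat \<Rightarrow> real) \<Rightarrow> real \<Rightarrow> (nat \<Rightarrow> real) \<Rightarrow> real" where
  "lasso p A r l x = 1/2 * quad_form p A x - (\<Sum>i<p. r i * x i) + l * (\<Sum>i<p. \<bar>x i\<bar>)"

text \<open>The gradient of the smooth part of the objective, for symmetric \<open>A\<close>.\<close>
definition lasso_grad :: "nat \<Rightarrow> (nat \<Rightarrow> nat \<Rightarrow> real) \<Rightarrow> (nat \<Rightarrow> real) \<Rightarrow> (nat \<Rightarrow> real) \<Rightarrow> nat \<Rightarrow> real" where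
  "lasso_grad p A r x i = (\<Sum>j<p. A i j * x j) - r i"

definition pos_semidef :: "nat \<Rightarrow> (nat \<Rightarrow> nat \<Rightarrow> real) \<Rightarrow> bool" where
  "pos_semidef p A \<longleftrightarrow> (\<forall>i<p. \<forall>j<p. A i j = A j i) \<and> (\<forall>x. 0 \<le> quad_form p A x)"

text \<open>A quantitative form of invertibility: \<open>inv_bound s A N\<close> says that the leading block of \<open>A\<close> of size
\<open>s\<close> has an inverse whose maximum absolute row sum is at most \<open>N\<close>. Stated through the
solutions \<open>x\<close> of \<open>A x = u\<close>, it can be perturbed and used without computing any inverse.\<close>
definition inv_bound :: "nat \<Rightarrow> (nat \<Rightarrow> nat \<Rightarrow> real) \<Rightarrow> real \<Rightarrow> bool" where
  "inv_bound s A N \<longleftrightarrow>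
     (\<forall>x \<tau>. (\<forall>i<s. \<bar>\<Sum>j<s. A i j * x j\<bar> \<le> \<tau>) \<longrightarrow> (\<forall>k<s. \<bar>x k\<bar> \<le> N * \<tau>))"

lemma quad_form_add:
  assumes "\<forall>i<p. \<forall>j<p. A i j = A j i"
  shows "quad_form p A (\<lambda>i. x i + h i) =
    quad_form p A x + 2 * (\<Sum>i<p. (\<Sum>j<p. A i j * x j) * h i) + quad_form p A h"
proof -
  have "(\<Sum>i<p. x i * (\<Sum>j<p. A i j * h j)) = (\<Sum>i<p. \<Sum>j<p. x i * A i j * h j)"
    by (simp add: sum_distrib_left mult.assoc)
  also have "\<dots> = (\<Sum>j<p. \<Sum>i<p. x i * A i j * h j)"
    by (rule sum.swap)
  also have "\<dots> = (\<Sum>i<p. (\<Sum>j<p. A i j * x j) * h i)"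
    by (auto simp: sum_distrib_right assms intro!: sum.cong)
  finally show ?thesis
    by (simp add: quad_form_def distrib_left distrib_right sum.distrib mult.commute[of "h _" "sum _ _"])
qed

text \<open>The increment of the objective splits into a quadratic remainder, which is nonnegative for positive
semidefinite \<open>A\<close>, and a sum over single coordinates. All optimality arguments below are therefore
arguments about one coordinate.\<close>
lemma lasso_add:
  assumes "\<forall>i<p. \<forall>j<p. A i j = A j i"
  shows "lasso p A r l (\<lambda>i. x i + h i) = lasso p A r l x + 1/2 * quad_form p A h
    + (\<Sum>i<p. lasso_grad p A r x i * h i + l * (\<bar>x i + h i\<bar> - \<bar>x i\<bar>))"
proof -
  have "(\<Sum>i<p. lasso_grad p A r x i * h i + l * (\<bar>x i + h i\<bar> - \<bar>x i\<bar>)) =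
      (\<Sum>i<p. (\<Sum>j<p. A i j * x j) * h i) - (\<Sum>i<p. r i * h i)
      + (l * (\<Sum>i<p. \<bar>x i + h i\<bar>) - l * (\<Sum>i<p. \<bar>x i\<bar>))"
    by (simp add: lasso_grad_def left_diff_distrib right_diff_distrib sum.distrib sum_subtractf
        flip: sum_distrib_left)
  then show ?thesis
    unfolding lasso_def quad_form_add[OF assms]
    by (simp add: distrib_left sum.distrib)
qed

text \<open>The Cauchy-Schwarz inequality for the semi-inner product of \<open>A\<close>, applied to \<open>x\<close> and a unit vector:
the quadratic \<open>t \<mapsto> quad_form p A (x + t e\<^sub>i)\<close> has no negative value.\<close>
lemma pos_semidef_row_sq_le:
  assumes A: "pos_semidef p A" and i: "i < p"
  shows "(\<Sum>j<p. A i j * x j)\<^sup>2 \<le> A i i * quad_form p A x"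
proof -
  define u where "u = (\<Sum>j<p. A i j * x j)"
  have sym: "\<forall>i<p. \<forall>j<p. A i j = A j i"
    and psd: "\<And>x. 0 \<le> quad_form p A x"
    using A by (auto simp: pos_semidef_def)
  have unit: "quad_form p A (\<lambda>k. if k = i then t else 0) = A i i * t\<^sup>2" for t
    using i by (simp add: quad_form_def if_distrib[of "\<lambda>z. _ * z"] if_distrib[of "\<lambda>z. z * _"]
        power2_eq_square mult.commute cong: if_cong)
  have q: "0 \<le> quad_form p A x + 2 * u * t + A i i * t\<^sup>2" for t
    using psd[of "\<lambda>k. x k + (if k = i then t else 0)"] i
    unfolding quad_form_add[OF sym] unit u_def
    by (simp add: if_distrib[of "\<lambda>z. _ * z"] cong: if_cong)
  show ?thesis
  proof (cases "A i i = 0")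
    case True
    have "u = 0"
    proof (rule ccontr)
      assume "u \<noteq> 0"
      then show False
        using q[of "- (quad_form p A x + 1) / (2 * u)"] True by (simp add: field_simps)
    qed
    then show ?thesis using True by (simp add: u_def)
  next
    case False
    have "0 \<le> A i i"
      using psd[of "\<lambda>k. if k = i then 1 else 0"] unit[of 1] by simp
    with False have pos: "0 < A i i" by simp
    have "0 \<le> A i i * (quad_form p A x + 2 * u * (- u / A i i) + A i i * (- u / A i i)\<^sup>2)"
      using q[of "- u / A i i"] pos by (intro mult_nonneg_nonneg) auto
    also have "\<dots> = A i i * quad_form p A x - u\<^sup>2"
      using pos by (simp add: field_simps power2_eq_square)
    finally show ?thesis by (simp add: u_def)
  qed
qed

section \<open>Optimality conditions\<close>

text \<open>Near the origin the linear term of a quadratic dominates, so it must not be negative if the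
quadratic is nonnegative to the right of the origin.\<close>
lemma linear_coeff_nonneg:
  fixes u a d :: real
  assumes "0 < d" and "\<And>t. 0 < t \<Longrightarrow> t \<le> d \<Longrightarrow> 0 \<le> u * t + a * t\<^sup>2"
  shows "0 \<le> u"
proof (rule ccontr)
  assume "\<not> 0 \<le> u"
  \<comment> \<open>Small enough that \<open>a * t\<close> cannot compensate \<open>u\<close>.\<close>
  define t where "t = min d (- u / (2 * (\<bar>a\<bar> + 1)))"
  have t: "0 < t" "t \<le> d" using \<open>\<not> 0 \<le> u\<close> assms(1) by (auto simp: t_def field_simps)
  have "t * (2 * (\<bar>a\<bar> + 1)) \<le> - u"
    by (subst pos_le_divide_eq[symmetric]) (auto simp: t_def)
  moreover have "a * t \<le> \<bar>a\<bar> * t" using t by (intro mult_right_mono) auto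
  moreover have "t * (2 * (\<bar>a\<bar> + 1)) = 2 * (\<bar>a\<bar> * t) + 2 * t" "0 \<le> \<bar>a\<bar> * t"
    using t by (auto simp: algebra_simps)
  ultimately have "u + a * t < 0" using t by linarith
  then have "(u + a * t) * t < 0" using t by (simp add: mult_neg_pos)
  then show False using assms(2)[OF t] by (simp add: algebra_simps power2_eq_square)
qed

text \<open>The subgradient condition at a minimum, in one variable: \<open>- g / l\<close> is a subgradient of the absolute
value at \<open>x\<close>. The equation \<open>g * x = - l * \<bar>x\<bar>\<close> expresses \<open>g = - l * sgn x\<close> for \<open>x \<noteq> 0\<close> and is void for
\<open>x = 0\<close>, which spares later proofs a case distinction.\<close>
lemma abs_kkt:
  fixes a g l x :: real
  assumes l: "0 < l" and min: "\<And>t. 0 \<le> a * t\<^sup>2 + g * t + l * (\<bar>x + t\<bar> - \<bar>x\<bar>)"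
  shows "\<bar>g\<bar> \<le> l" and "g * x = - l * \<bar>x\<bar>"
proof -
  have *: "0 \<le> l + g" "0 \<le> l - g" if "x = 0"
  proof -
    show "0 \<le> l + g"
    proof (rule linear_coeff_nonneg[of 1 _ a])
      fix t :: real assume "0 < t"
      then show "0 \<le> (l + g) * t + a * t\<^sup>2" using min[of t] that by (simp add: algebra_simps)
    qed simp
    show "0 \<le> l - g"
    proof (rule linear_coeff_nonneg[of 1 _ a])
      fix t :: real assume "0 < t"
      then show "0 \<le> (l - g) * t + a * t\<^sup>2" using min[of "- t"] that by (simp add: algebra_simps)
    qed simp
  qed
  have **: "g = - l * sgn x" if "x \<noteq> 0"
  proof -
    have abs: "\<bar>x + t\<bar> - \<bar>x\<bar> = sgn x * t" if "\<bar>t\<bar> \<le> \<bar>x\<bar>" for t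
      using \<open>x \<noteq> 0\<close> that by (auto simp: sgn_if abs_if split: if_splits)
    have "0 \<le> g + l * sgn x"
    proof (rule linear_coeff_nonneg[of "\<bar>x\<bar>" _ a])
      fix t assume "0 < t" "t \<le> \<bar>x\<bar>"
      then show "0 \<le> (g + l * sgn x) * t + a * t\<^sup>2"
        using min[of t] abs[of t] by (simp only:) (simp add: algebra_simps)
    qed (use that in auto)
    moreover have "0 \<le> - (g + l * sgn x)"
    proof (rule linear_coeff_nonneg[of "\<bar>x\<bar>" _ a])
      fix t assume "0 < t" "t \<le> \<bar>x\<bar>"
      then show "0 \<le> - (g + l * sgn x) * t + a * t\<^sup>2"
        using min[of "- t"] abs[of "- t"] by (simp only: abs_minus_cancel abs_of_pos) (simp add: algebra_simps)
    qed (use that in auto)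
    ultimately show ?thesis by simp
  qed
  show "\<bar>g\<bar> \<le> l" using * ** l by (cases "x = 0") (auto simp: abs_mult sgn_if)
  show "g * x = - l * \<bar>x\<bar>" using ** by (cases "x = 0") (auto simp: sgn_if)
qed

text \<open>A minimizer stays a minimizer along every coordinate axis, where the increment has the form
treated in the scalar case.\<close>
lemma lasso_minimizer_kkt:
  assumes sym: "\<forall>i<p. \<forall>j<p. A i j = A j i"
    and l: "0 < l" and k: "k < p"
    and min: "\<And>y. lasso p A r l x \<le> lasso p A r l y"
  shows "\<bar>lasso_grad p A r x k\<bar> \<le> l" and "lasso_grad p A r x k * x k = - l * \<bar>x k\<bar>"
proof -
  have "0 \<le> (A k k / 2) * t\<^sup>2 + lasso_grad p A r x k * t + l * (\<bar>x k + t\<bar> - \<bar>x k\<bar>)" for t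
  proof -
    define h where "h = (\<lambda>i. if i = k then t else 0)"
    have "quad_form p A h = A k k * t\<^sup>2"
      using k by (simp add: h_def quad_form_def if_distrib[of "\<lambda>z. _ * z"] if_distrib[of "\<lambda>z. z * _"]
        power2_eq_square mult.commute cong: if_cong)
    moreover have "(\<Sum>i<p. lasso_grad p A r x i * h i + l * (\<bar>x i + h i\<bar> - \<bar>x i\<bar>))
      = (\<Sum>i<p. if i = k then lasso_grad p A r x k * t + l * (\<bar>x k + t\<bar> - \<bar>x k\<bar>) else 0)"
      by (intro sum.cong) (auto simp: h_def)
    ultimately show ?thesis
      using min[of "\<lambda>i. x i + h i"] k unfolding lasso_add[OF sym] by simp
  qed
  from abs_kkt[OF l this]
  show "\<bar>lasso_grad p A r x k\<bar> \<le> l" and "lasso_grad p A r x k * x k = - l * \<bar>x k\<bar>" by auto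
qed

section \<open>Perturbed inverses and existence of minimizers\<close>

text \<open>If \<open>A\<close> is entrywise \<open>d\<close>-close to \<open>K\<close>, then \<open>K x = A x - (A - K) x\<close>, and the last term is at most
\<open>s * d\<close> times the largest entry of \<open>x\<close>. When \<open>N * s * d\<close> is at most one half, it can be absorbed.\<close>
lemma inv_bound_perturb:
  assumes K: "inv_bound s K N" and N: "0 \<le> N"
    and d: "\<And>i j. i < s \<Longrightarrow> j < s \<Longrightarrow> \<bar>A i j - K i j\<bar> \<le> d"
    and small: "2 * N * d * real s \<le> 1"
  shows "inv_bound s A (2 * N)"
  unfolding inv_bound_def
proof (intro allI impI)
  fix x :: "nat \<Rightarrow> real" and \<tau> k
  assume \<tau>: "\<forall>i<s. \<bar>\<Sum>j<s. A i j * x j\<bar> \<le> \<tau>" and k: "k < s"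
  define m where "m = Max ((\<lambda>i. \<bar>x i\<bar>) ` {..<s})"
  have m: "\<bar>x i\<bar> \<le> m" if "i < s" for i
    using that by (auto simp: m_def)
  have "m \<in> (\<lambda>i. \<bar>x i\<bar>) ` {..<s}"
    unfolding m_def using k by (intro Max_in) auto
  then obtain i0 where i0: "i0 < s" "m = \<bar>x i0\<bar>" by auto
  have "\<bar>\<Sum>j<s. K i j * x j\<bar> \<le> \<tau> + real s * (d * m)" if i: "i < s" for i
  proof -
    have "(\<Sum>j<s. K i j * x j) = (\<Sum>j<s. A i j * x j) - (\<Sum>j<s. (A i j - K i j) * x j)"
      by (simp add: sum_subtractf algebra_simps)
    moreover have "\<bar>\<Sum>j<s. (A i j - K i j) * x j\<bar> \<le> (\<Sum>j<s. \<bar>A i j - K i j\<bar> * \<bar>x j\<bar>)"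
      by (rule order_trans[OF sum_abs]) (simp add: abs_mult)
    moreover have "\<dots> \<le> (\<Sum>j<s. d * m)"
      using d[OF i] m by (intro sum_mono mult_mono) (auto intro: order_trans[OF abs_ge_zero])
    ultimately show ?thesis using \<tau> i by fastforce
  qed
  then have "m \<le> N * (\<tau> + real s * (d * m))"
    using K i0 unfolding inv_bound_def by blast
  also have "\<dots> = N * \<tau> + (2 * N * d * real s) * (m / 2)" by (simp add: algebra_simps)
  also have "\<dots> \<le> N * \<tau> + 1 * (m / 2)"
    using small i0 by (intro add_left_mono mult_right_mono) auto
  finally show "\<bar>x k\<bar> \<le> 2 * N * \<tau>" using m[OF k] by simp
qed

text \<open>Positive definiteness in quantitative form. A small value of the quadratic form forces all
entries of \<open>A x\<close> to be small by Cauchy-Schwarz, and these control the entries of \<open>x\<close>. This gives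
coercivity and uniqueness without the spectral theorem.\<close>
lemma quad_form_lower:
  assumes A: "pos_semidef s A" and N: "inv_bound s A N" and k: "k < s"
    and "0 \<le> N"
  shows "(x k)\<^sup>2 \<le> N\<^sup>2 * (\<Sum>i<s. A i i) * quad_form s A x"
proof -
  have psd: "\<And>x. 0 \<le> quad_form s A x" using A by (auto simp: pos_semidef_def)
  have diag: "0 \<le> A i i" if "i < s" for i
    using psd[of "\<lambda>k. if k = i then 1 else 0"] that
    by (simp add: quad_form_def if_distrib[of "\<lambda>z. _ * z"] if_distrib[of "\<lambda>z. z * _"] cong: if_cong)
  define \<tau> where "\<tau> = sqrt ((\<Sum>i<s. A i i) * quad_form s A x)"
  have \<tau>0: "0 \<le> (\<Sum>i<s. A i i) * quad_form s A x"
    using diag psd by (intro mult_nonneg_nonneg sum_nonneg) auto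
  have "\<bar>\<Sum>j<s. A i j * x j\<bar> \<le> \<tau>" if i: "i < s" for i
    unfolding \<tau>_def
  proof (rule real_le_rsqrt)
    have "\<bar>\<Sum>j<s. A i j * x j\<bar>\<^sup>2 \<le> A i i * quad_form s A x"
      using pos_semidef_row_sq_le[OF A i] by simp
    also have "\<dots> \<le> (\<Sum>i<s. A i i) * quad_form s A x"
      using psd diag i by (intro mult_right_mono member_le_sum) auto
    finally show "\<bar>\<Sum>j<s. A i j * x j\<bar>\<^sup>2 \<le> (\<Sum>i<s. A i i) * quad_form s A x" .
  qed
  then have "\<bar>x k\<bar> \<le> N * \<tau>" using N k unfolding inv_bound_def by blast
  then have "\<bar>x k\<bar>\<^sup>2 \<le> (N * \<tau>)\<^sup>2" by (rule power_mono) simp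
  then show ?thesis
    using \<tau>0 by (simp add: \<tau>_def power_mult_distrib)
qed

text \<open>Vectors of length \<open>s\<close>, as functions that vanish from \<open>s\<close> on, form a product of compact intervals,
so Tychonoff's theorem applies.\<close>
lemma compact_box:
  "compact {x :: nat \<Rightarrow> real. (\<forall>i<s. \<bar>x i\<bar> \<le> R) \<and> (\<forall>i\<ge>s. x i = 0)}"
proof -
  have "{x :: nat \<Rightarrow> real. (\<forall>i<s. \<bar>x i\<bar> \<le> R) \<and> (\<forall>i\<ge>s. x i = 0)}
     = PiE UNIV (\<lambda>i. if i < s then {-R..R} else {0})"
    by (auto simp: PiE_UNIV_domain Pi_iff abs_le_iff split: if_splits) (smt (verit) not_less)+
  moreover have "compactin (product_topology (\<lambda>_. euclidean) UNIV) (PiE UNIV (\<lambda>i. if i < s then {-R..R::real} else {0}))"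
    by (subst compactin_PiE) auto
  ultimately show ?thesis
    by (simp add: euclidean_product_topology)
qed

text \<open>On the sublevel set of the value \<open>0\<close>, attained at the origin, the quadratic term is at most linear in
the largest entry of \<open>x\<close>, while it grows quadratically. The sublevel set thus lies in a box, where
continuity and compactness yield a minimum.\<close>
lemma lasso_minimizer_exists:
  assumes A: "pos_semidef s A" and N: "inv_bound s A N" and N0: "0 \<le> N" and l: "0 \<le> l"
  obtains x where "\<And>y. lasso s A r l x \<le> lasso s A r l y" and "\<And>i. s \<le> i \<Longrightarrow> x i = 0"
proof -
  define a where "a = N\<^sup>2 * (\<Sum>i<s. A i i)"
  define R where "R = 2 * a * (\<Sum>i<s. \<bar>r i\<bar>)"
  have a: "(x k)\<^sup>2 \<le> a * quad_form s A x" if "k < s" for x k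
    using quad_form_lower[OF A N that N0] by (simp add: a_def)
  have psd: "\<And>x. 0 \<le> quad_form s A x" using A by (auto simp: pos_semidef_def)
  have "0 \<le> A i i" if "i < s" for i
    using psd[of "\<lambda>k. if k = i then 1 else 0"] that
    by (simp add: quad_form_def if_distrib[of "\<lambda>z. _ * z"] if_distrib[of "\<lambda>z. z * _"] cong: if_cong)
  then have a0: "0 \<le> a" by (auto simp: a_def intro!: mult_nonneg_nonneg sum_nonneg)
  then have R0: "0 \<le> R" by (auto simp: R_def intro!: mult_nonneg_nonneg sum_nonneg)
  have coercive: "\<bar>x k\<bar> \<le> R" if le: "lasso s A r l x \<le> 0" and k: "k < s" for x k
  proof -
    define m where "m = Max ((\<lambda>i. \<bar>x i\<bar>) ` {..<s})"
    have m: "\<bar>x i\<bar> \<le> m" if "i < s" for i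
      using that by (auto simp: m_def)
    have "m \<in> (\<lambda>i. \<bar>x i\<bar>) ` {..<s}"
      unfolding m_def using k by (intro Max_in) auto
    then obtain i0 where i0: "i0 < s" "m = \<bar>x i0\<bar>" by auto
    have "(\<Sum>i<s. r i * x i) \<le> (\<Sum>i<s. \<bar>r i\<bar>) * m"
      unfolding sum_distrib_right
    proof (rule sum_mono)
      fix i assume "i \<in> {..<s}"
      then have "\<bar>r i\<bar> * \<bar>x i\<bar> \<le> \<bar>r i\<bar> * m" using m by (intro mult_left_mono) auto
      then show "r i * x i \<le> \<bar>r i\<bar> * m" using abs_ge_self[of "r i * x i"] by (simp add: abs_mult)
    qed
    moreover have "0 \<le> l * (\<Sum>i<s. \<bar>x i\<bar>)" using l by (simp add: sum_nonneg)
    ultimately have "quad_form s A x \<le> 2 * (\<Sum>i<s. \<bar>r i\<bar>) * m"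
      using le by (simp add: lasso_def)
    then have "a * quad_form s A x \<le> a * (2 * (\<Sum>i<s. \<bar>r i\<bar>) * m)"
      using a0 by (rule mult_left_mono)
    then have "m * m \<le> R * m"
      using a[OF i0(1), of x] i0(2) by (simp add: R_def power2_eq_square algebra_simps)
    then have "m \<le> R" using R0 i0(2)
      by (cases "m = 0") (auto intro: mult_right_le_imp_le[where c = m])
    then show ?thesis using m[OF k] by simp
  qed
  define B where "B = {x :: nat \<Rightarrow> real. (\<forall>i<s. \<bar>x i\<bar> \<le> R) \<and> (\<forall>i\<ge>s. x i = 0)}"
  have zero: "(\<lambda>_. 0) \<in> B" using R0 by (simp add: B_def)
  then have ne: "B \<noteq> {}" by blast
  have cont: "continuous_on B (lasso s A r l)"
    unfolding lasso_def[abs_def] quad_form_def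
    by (intro continuous_intros) (auto intro: continuous_on_subset[OF continuous_on_product_coordinates])
  obtain x where x: "x \<in> B" "\<And>y. y \<in> B \<Longrightarrow> lasso s A r l x \<le> lasso s A r l y"
    using continuous_attains_inf[OF compact_box[of s R, folded B_def] ne cont] by blast
  have x_le_0: "lasso s A r l x \<le> 0"
    using x(2)[OF zero] by (simp add: lasso_def quad_form_def)
  have "lasso s A r l x \<le> lasso s A r l y" for y
  proof (cases "lasso s A r l y \<le> 0")
    case True
    have "lasso s A r l y = lasso s A r l (\<lambda>i. if i < s then y i else 0)"
      by (simp add: lasso_def quad_form_def)
    also have "lasso s A r l x \<le> \<dots>"
      using coercive[OF True] by (intro x(2)) (auto simp: B_def)
    finally show ?thesis .
  qed (use x_le_0 in simp)
  then show thesis using x(1) that by (auto simp: B_def)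
qed

section \<open>Support recovery by a primal-dual witness\<close>

lemma sum_supported:
  fixes f :: "nat \<Rightarrow> real"
  assumes "s \<le> p" "\<And>i. s \<le> i \<Longrightarrow> i < p \<Longrightarrow> f i = 0"
  shows "(\<Sum>i<p. f i) = (\<Sum>i<s. f i)"
  using assms by (intro sum.mono_neutral_right) auto

lemma quad_form_supported:
  assumes "s \<le> p" "\<And>i. s \<le> i \<Longrightarrow> i < p \<Longrightarrow> x i = 0"
  shows "quad_form p A x = quad_form s A x"
  using assms by (simp add: quad_form_def sum_supported[OF assms(1)])

lemma pos_semidef_leading:
  assumes "pos_semidef p A" "s \<le> p"
  shows "pos_semidef s A"
proof -
  have "0 \<le> quad_form s A x" for x
  proof -
    have "quad_form p A (\<lambda>i. if i < s then x i else 0) = quad_form s A (\<lambda>i. if i < s then x i else 0)"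
      by (rule quad_form_supported[OF assms(2)]) auto
    also have "\<dots> = quad_form s A x" by (simp add: quad_form_def)
    finally show ?thesis using assms(1) unfolding pos_semidef_def by metis
  qed
  then show ?thesis using assms by (auto simp: pos_semidef_def)
qed

text \<open>Sufficiency of the subgradient conditions. Each coordinate contributes a nonnegative increment;
outside the support the contribution is at least \<open>(l - \<bar>g\<^sub>i\<bar>) * \<bar>h\<^sub>i\<bar>\<close>, which is positive as soon as
\<open>h\<^sub>i \<noteq> 0\<close>. A competing minimizer therefore agrees with \<open>x\<close> outside the support, and on the support
the quadratic form is definite.\<close>
lemma lasso_strict_dual_feasibility:
  assumes A: "pos_semidef p A" and sp: "s \<le> p" and N: "inv_bound s A N" "0 \<le> N"
    and on: "\<And>i. i < s \<Longrightarrow> \<bar>lasso_grad p A r x i\<bar> \<le> l"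
      "\<And>i. i < s \<Longrightarrow> lasso_grad p A r x i * x i = - l * \<bar>x i\<bar>"
    and off: "\<And>i. s \<le> i \<Longrightarrow> i < p \<Longrightarrow> \<bar>lasso_grad p A r x i\<bar> < l"
    and supp: "\<And>i. s \<le> i \<Longrightarrow> x i = 0"
  shows "lasso p A r l x \<le> lasso p A r l y"
    and "lasso p A r l y \<le> lasso p A r l x \<Longrightarrow> i < p \<Longrightarrow> y i = x i"
proof -
  define h where "h = (\<lambda>i. y i - x i)"
  define g where "g = lasso_grad p A r x"
  define D where "D = (\<lambda>i. g i * h i + l * (\<bar>x i + h i\<bar> - \<bar>x i\<bar>))"
  have sym: "\<forall>i<p. \<forall>j<p. A i j = A j i"
    and psd: "\<And>x. 0 \<le> quad_form p A x"
    using A by (auto simp: pos_semidef_def)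
  have diff: "lasso p A r l y = lasso p A r l x + 1/2 * quad_form p A h + (\<Sum>i<p. D i)"
    using lasso_add[OF sym, where x = x and h = h and r = r and l = l] by (simp add: h_def D_def g_def)
  have D_on: "0 \<le> D i" if "i < s" for i
  proof -
    have "- (g i * (x i + h i)) \<le> \<bar>g i\<bar> * \<bar>x i + h i\<bar>" by (simp add: abs_mult[symmetric])
    also have "\<dots> \<le> l * \<bar>x i + h i\<bar>" using on(1)[OF that] by (intro mult_right_mono) (auto simp: g_def)
    finally show ?thesis using on(2)[OF that] by (simp add: D_def g_def algebra_simps)
  qed
  have D_off: "(l - \<bar>g i\<bar>) * \<bar>h i\<bar> \<le> D i" if "s \<le> i" for i
  proof -
    have "- (g i * h i) \<le> \<bar>g i\<bar> * \<bar>h i\<bar>" by (simp add: abs_mult[symmetric])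
    then show ?thesis using supp[OF that] by (simp add: D_def algebra_simps)
  qed
  have D0: "0 \<le> D i" if "i < p" for i
  proof (cases "i < s")
    case False
    then have "0 \<le> (l - \<bar>g i\<bar>) * \<bar>h i\<bar>"
      using off[of i] that by (intro mult_nonneg_nonneg) (auto simp: g_def)
    then show ?thesis using D_off[of i] False by simp
  qed (rule D_on)
  then have sumD: "0 \<le> (\<Sum>i<p. D i)" by (intro sum_nonneg) auto
  show "lasso p A r l x \<le> lasso p A r l y" using diff psd[of h] sumD by simp
  assume le: "lasso p A r l y \<le> lasso p A r l x" and i: "i < p"
  have "(\<Sum>i<p. D i) = 0" and q0: "quad_form p A h = 0"
    using le diff psd[of h] sumD by auto
  then have D_zero: "D i = 0" if "i < p" for i
    using D0 that by (subst (asm) sum_nonneg_eq_0_iff) auto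
  have h_off: "h i = 0" if "s \<le> i" "i < p" for i
  proof (rule ccontr)
    assume "h i \<noteq> 0"
    then have "0 < (l - \<bar>g i\<bar>) * \<bar>h i\<bar>"
      using off[OF that] by (intro mult_pos_pos) (auto simp: g_def)
    then show False using D_off[OF that(1)] D_zero[OF that(2)] by simp
  qed
  have "quad_form s A h = 0" using q0 quad_form_supported[of s p h A] sp h_off by simp
  then have "h i = 0" if "i < s" for i
    using quad_form_lower[OF pos_semidef_leading[OF A sp] N(1) that N(2), of h] by simp
  then show "y i = x i" using h_off i by (cases "i < s") (auto simp: h_def)
qed

text \<open>The primal-dual witness construction. The witness \<open>x\<close> minimizes the objective restricted to the
first \<open>s\<close> coordinates. With \<open>\<Delta> = x - \<beta>\<close>, its optimality conditions say that \<open>A \<Delta>\<close> has entries at most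
\<open>l\<close> up to perturbations on the first \<open>s\<close> rows, and inverting \<open>A\<close> there bounds \<open>\<Delta>\<close>. On the remaining
rows, \<open>K \<Delta>\<close> is at most \<open>1 - \<gamma>\<close> times its size on the first \<open>s\<close> rows; this leaves a slack \<open>\<gamma> * l\<close>,
large enough to swallow all perturbations, so that the dual variable is strictly feasible and
\<open>x\<close> is the only minimizer of the unrestricted problem.

The hypothesis \<open>irrep\<close> is the irrepresentable condition, again phrased through solutions instead of
the inverse matrix. The vector \<open>r\<close> is compared with \<open>K \<beta>\<close> directly, so \<open>e\<close> has to cover both the
surrogate error and the noise.\<close>
lemma lasso_support_recovery:
  assumes A: "pos_semidef p A" and sp: "s \<le> p"
    and K: "inv_bound s K N" and N: "0 \<le> N"
    and irrep: "\<And>x \<tau> j. \<lbrakk>\<And>i. i < s \<Longrightarrow> \<bar>\<Sum>k<s. K i k * x k\<bar> \<le> \<tau>; s \<le> j; j < p\<rbrakk> \<Longrightarrow>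
      \<bar>\<Sum>k<s. K j k * x k\<bar> \<le> (1 - \<gamma>) * \<tau>"
    and \<gamma>: "0 < \<gamma>" "\<gamma> \<le> 1"
    and d: "\<And>i j. i < p \<Longrightarrow> j < p \<Longrightarrow> \<bar>A i j - K i j\<bar> \<le> d"
    and d_small: "16 * d * real s * N \<le> \<gamma>"
    and e: "\<And>i. i < p \<Longrightarrow> \<bar>r i - (\<Sum>k<s. K i k * \<beta> k)\<bar> \<le> e"
    and e_small: "e + d * (\<Sum>k<s. \<bar>\<beta> k\<bar>) \<le> \<gamma> * l / 8"
    and l: "0 < l" and s: "0 < s"
  obtains x where "\<And>i. s \<le> i \<Longrightarrow> x i = 0" and "\<And>k. k < s \<Longrightarrow> \<bar>x k - \<beta> k\<bar> \<le> 4 * N * l"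
    and "\<And>y. lasso p A r l x \<le> lasso p A r l y"
    and "\<And>y i. lasso p A r l y \<le> lasso p A r l x \<Longrightarrow> i < p \<Longrightarrow> y i = x i"
proof -
  \<comment> \<open>A bound for the deviation of the gradient at \<open>x\<close> from \<open>A \<Delta>\<close>: error in \<open>r\<close>, and the error of \<open>A\<close> acting on \<open>\<beta>\<close>.\<close>
  define q where "q = e + d * (\<Sum>k<s. \<bar>\<beta> k\<bar>)"
  have A_s: "pos_semidef s A" by (rule pos_semidef_leading[OF A sp])
  have d0: "0 \<le> d" using d[of 0 0] s sp by auto
  have "8 * (2 * N * d * real s) \<le> 8" using d_small \<gamma> by (simp add: algebra_simps)
  then have small: "2 * N * d * real s \<le> 1" by simp
  have inv_A: "inv_bound s A (2 * N)"
    using d sp by (intro inv_bound_perturb[OF K N _ small]) auto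
  have N2: "0 \<le> 2 * N" using N by simp
  obtain x where x_min: "\<And>y. lasso s A r l x \<le> lasso s A r l y" and supp: "\<And>i. s \<le> i \<Longrightarrow> x i = 0"
    using lasso_minimizer_exists[OF A_s inv_A N2 less_imp_le[OF l]] by blast
  have sym_s: "\<forall>i<s. \<forall>j<s. A i j = A j i"
    using A_s by (auto simp: pos_semidef_def)
  have grad: "lasso_grad p A r x i = lasso_grad s A r x i" for i
    unfolding lasso_grad_def using supp by (subst sum_supported[OF sp]) auto
  have kkt: "\<bar>lasso_grad p A r x i\<bar> \<le> l" "lasso_grad p A r x i * x i = - l * \<bar>x i\<bar>"
    if "i < s" for i
    using lasso_minimizer_kkt[OF sym_s l that x_min] by (simp_all add: grad)
  define \<Delta> where "\<Delta> = (\<lambda>i. x i - \<beta> i)"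
  have dev: "\<bar>lasso_grad p A r x i - (\<Sum>k<s. A i k * \<Delta> k)\<bar> \<le> q" if i: "i < p" for i
  proof -
    have "lasso_grad p A r x i - (\<Sum>k<s. A i k * \<Delta> k) = (\<Sum>k<s. (A i k - K i k) * \<beta> k) - (r i - (\<Sum>k<s. K i k * \<beta> k))"
      unfolding grad by (simp add: lasso_grad_def \<Delta>_def algebra_simps sum_subtractf sum.distrib)
    moreover have "\<bar>\<Sum>k<s. (A i k - K i k) * \<beta> k\<bar> \<le> (\<Sum>k<s. d * \<bar>\<beta> k\<bar>)"
      using d i sp by (intro order_trans[OF sum_abs] sum_mono) (auto simp: abs_mult intro!: mult_right_mono)
    ultimately show ?thesis using e[OF i] by (simp add: q_def sum_distrib_left)
  qed
  have q_le: "q \<le> \<gamma> * l / 8" using e_small by (simp add: q_def)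
  moreover have "\<gamma> * l \<le> 1 * l" using \<gamma> l by (intro mult_right_mono) auto
  ultimately have q_l: "q \<le> l" using l by linarith
  have "\<bar>\<Sum>k<s. A i k * \<Delta> k\<bar> \<le> l + q" if "i < s" for i
    using dev[of i] kkt(1)[OF that] that sp by simp
  then have \<Delta>_bd: "\<bar>\<Delta> k\<bar> \<le> 2 * N * (l + q)" if "k < s" for k
    using inv_A that unfolding inv_bound_def by blast
  have "2 * N * (l + q) \<le> 2 * N * (l + l)" using q_l N by (intro mult_left_mono) auto
  then have \<Delta>_bd': "\<bar>\<Delta> k\<bar> \<le> 4 * N * l" if "k < s" for k
    using \<Delta>_bd[OF that] by simp
  \<comment> \<open>A bound for \<open>(A - K) \<Delta>\<close>.\<close>
  define t where "t = real s * (d * (4 * N * l))"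
  have t_le: "t \<le> \<gamma> * l / 4" using mult_right_mono[OF d_small less_imp_le[OF l]]
    by (simp add: t_def algebra_simps)
  have t0: "0 \<le> t" using d0 N l by (simp add: t_def)
  have AK: "\<bar>(\<Sum>k<s. A i k * \<Delta> k) - (\<Sum>k<s. K i k * \<Delta> k)\<bar> \<le> t" if "i < p" for i
  proof -
    have "\<bar>(\<Sum>k<s. A i k * \<Delta> k) - (\<Sum>k<s. K i k * \<Delta> k)\<bar> = \<bar>\<Sum>k<s. (A i k - K i k) * \<Delta> k\<bar>"
      by (simp add: algebra_simps sum_subtractf)
    also have "\<dots> \<le> (\<Sum>k<s. d * (4 * N * l))"
      using d that sp \<Delta>_bd' d0 by (intro order_trans[OF sum_abs] sum_mono) (auto simp: abs_mult intro!: mult_mono)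
    finally show ?thesis by (simp add: t_def)
  qed
  have K_on: "\<bar>\<Sum>k<s. K i k * \<Delta> k\<bar> \<le> l + q + t" if "i < s" for i
    using AK[of i] dev[of i] kkt(1)[OF that] that sp by simp
  have off: "\<bar>lasso_grad p A r x j\<bar> < l" if j: "s \<le> j" "j < p" for j
  proof -
    have "\<bar>\<Sum>k<s. K j k * \<Delta> k\<bar> \<le> (1 - \<gamma>) * (l + q + t)"
      using K_on j by (intro irrep) auto
    moreover have "0 \<le> q" using dev[of 0] s sp by simp
    then have "0 \<le> \<gamma> * (q + t)" using t0 \<gamma> by simp
    moreover have "(1 - \<gamma>) * (l + q + t) = l - \<gamma> * l + q + t - \<gamma> * (q + t)"
      by (simp add: algebra_simps)
    moreover have "0 < \<gamma> * l" using \<gamma> l by simp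
    ultimately show ?thesis using dev[OF j(2)] AK[OF j(2)] q_le t_le by linarith
  qed
  have "lasso p A r l x \<le> lasso p A r l y" for y
    by (rule lasso_strict_dual_feasibility(1)[OF A sp inv_A N2]) (use kkt off supp in auto)
  moreover have "y i = x i" if "lasso p A r l y \<le> lasso p A r l x" "i < p" for y i
    by (rule lasso_strict_dual_feasibility(2)[OF A sp inv_A N2 _ _ _ _ that]) (use kkt off supp in auto)
  ultimately show thesis
    using that[of x] supp \<Delta>_bd' unfolding \<Delta>_def by blast
qed

section \<open>Exponential moments of sub-Gaussian variables\<close>

text \<open>This bound trades \<open>exp x\<close> for its linear part, which has mean zero under a centred distribution,
plus an exponential of the square.\<close>
lemma exp_le_add_exp_sq: "exp x \<le> x + exp (x\<^sup>2)" for x :: real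
proof -
  have sq: "1 + x\<^sup>2 \<le> exp (x\<^sup>2)" by (rule exp_ge_add_one_self)
  consider "1 \<le> x" | "0 \<le> x" "x \<le> 1" | "- 1 \<le> x" "x \<le> 0" | "x \<le> - 1" by linarith
  then show ?thesis
  proof cases
    case 1
    then have "x \<le> x\<^sup>2" by (simp add: power2_eq_square)
    then have "exp x \<le> exp (x\<^sup>2)" by simp
    then show ?thesis using 1 by linarith
  next
    case 2
    then show ?thesis using exp_bound[of x] sq by linarith
  next
    case 3
    have "1 \<le> (1 + x + x\<^sup>2) * (1 - x)"
    proof -
      have "(1 + x + x\<^sup>2) * (1 - x) = 1 - x ^ 3" by (simp add: algebra_simps power2_eq_square power3_eq_cube)
      moreover have "x ^ 3 \<le> 0" using 3 by (simp add: power3_eq_cube mult_nonneg_nonpos)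
      ultimately show ?thesis by simp
    qed
    also have "\<dots> \<le> (1 + x + x\<^sup>2) * exp (- x)"
      using exp_ge_add_one_self[of "- x"] 3 by (intro mult_left_mono) auto
    finally have "exp x \<le> 1 + x + x\<^sup>2" by (simp add: exp_minus field_simps)
    then show ?thesis using sq by linarith
  next
    case 4
    have "0 \<le> x * (x + 1)" using 4 by (intro mult_nonpos_nonpos) auto
    then have "1 \<le> x + (1 + x\<^sup>2)" by (simp add: power2_eq_square algebra_simps)
    moreover have "exp x \<le> 1" using 4 by simp
    ultimately show ?thesis using sq by linarith
  qed
qed

lemma exp_convex_unit: "exp (\<theta> * y) \<le> 1 + \<theta> * (exp y - 1)" if "0 \<le> \<theta>" "\<theta> \<le> 1" for \<theta> y :: real
proof -
  have "exp ((1 - \<theta>) *\<^sub>R 0 + \<theta> *\<^sub>R y) \<le> (1 - \<theta>) * exp 0 + \<theta> * exp y"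
    using that by (intro convex_onD[OF exp_convex]) auto
  then show ?thesis by (simp add: algebra_simps)
qed

text \<open>A discrete layer-cake bound: on the layer \<open>(k + 1, k + 2]\<close> the \<open>k\<close>-th summand alone exceeds \<open>exp y\<close>.
Integrating it turns tail probabilities into an exponential moment.\<close>
lemma exp_le_layers:
  fixes y :: real
  assumes "0 \<le> y"
  shows "ennreal (exp y) \<le> ennreal (exp 1) + (\<Sum>k. ennreal (exp (real k + 2)) * indicator {real k + 1<..} y)"
proof (cases "y \<le> 1")
  case True
  then have "ennreal (exp y) \<le> ennreal (exp 1)" by (intro ennreal_leI) simp
  then show ?thesis by (rule order_trans) simp
next
  case False
  define f where "f = (\<lambda>k. ennreal (exp (real k + 2)) * indicator {real k + 1<..} y)"
  define k where "k = nat \<lceil>y\<rceil> - 2"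
  have "real k + 1 < y" "y \<le> real k + 2"
    using False by (auto simp: k_def of_nat_diff) linarith+
  then have "ennreal (exp y) \<le> f k"
    by (auto simp: f_def intro!: ennreal_leI)
  also have "f k \<le> suminf f"
    using sum_le_suminf[of f "{k}"] by simp
  also have "\<dots> \<le> ennreal (exp 1) + suminf f" by simp
  finally show ?thesis by (simp add: f_def)
qed

text \<open>With the scale \<open>1 / (4 * v)\<close> the layer at height \<open>k + 1\<close> has probability at most
\<open>2 * exp (- 2 * (k + 1))\<close> and height at most \<open>exp (k + 2)\<close>, so the layers sum like a geometric series.\<close>
lemma (in prob_space) exp_square_moment_le:
  assumes [measurable]: "U \<in> borel_measurable M" and v: "0 < v"
    and tail: "\<And>t. 0 < t \<Longrightarrow> prob {\<omega> \<in> space M. t < \<bar>U \<omega>\<bar>} \<le> 2 * exp (- (t\<^sup>2 / (2 * v)))"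
  shows "(\<integral>\<^sup>+\<omega>. ennreal (exp ((U \<omega>)\<^sup>2 / (4 * v))) \<partial>M) \<le> ennreal 7"
proof -
  let ?y = "\<lambda>\<omega>. (U \<omega>)\<^sup>2 / (4 * v)"
  have "(\<integral>\<^sup>+\<omega>. ennreal (exp (?y \<omega>)) \<partial>M)
      \<le> (\<integral>\<^sup>+\<omega>. ennreal (exp 1) + (\<Sum>k. ennreal (exp (real k + 2)) * indicator {real k + 1<..} (?y \<omega>)) \<partial>M)"
    using v by (intro nn_integral_mono exp_le_layers) auto
  also have "\<dots> = ennreal (exp 1) + (\<Sum>k. \<integral>\<^sup>+\<omega>. ennreal (exp (real k + 2)) * indicator {real k + 1<..} (?y \<omega>) \<partial>M)"
    by (simp add: nn_integral_add nn_integral_suminf emeasure_space_1)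
  also have "\<dots> \<le> ennreal (exp 1) + (\<Sum>k. ennreal (2 * (1/2) ^ k))"
  proof (intro add_left_mono suminf_le)
    fix k :: nat
    \<comment> \<open>The level of \<open>\<bar>U\<bar>\<close> at which the exponent reaches \<open>k + 1\<close>.\<close>
    define t where "t = sqrt (4 * v * (real k + 1))"
    have t: "0 < t" "t\<^sup>2 = 4 * v * (real k + 1)" using v by (auto simp: t_def)
    have lt: "t < \<bar>U \<omega>\<bar> \<longleftrightarrow> real k + 1 < ?y \<omega>" for \<omega>
    proof -
      have "t < \<bar>U \<omega>\<bar> \<longleftrightarrow> t\<^sup>2 < (U \<omega>)\<^sup>2"
        using abs_le_square_iff[of "U \<omega>" t] t(1) by (simp add: not_le[symmetric])
      then show ?thesis using v by (simp add: t(2) field_simps)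
    qed
    have "(\<integral>\<^sup>+\<omega>. ennreal (exp (real k + 2)) * indicator {real k + 1<..} (?y \<omega>) \<partial>M)
        = ennreal (exp (real k + 2)) * (\<integral>\<^sup>+\<omega>. indicator {\<omega> \<in> space M. t < \<bar>U \<omega>\<bar>} \<omega> \<partial>M)"
      by (subst nn_integral_cmult[symmetric]) (auto simp: lt indicator_def intro!: nn_integral_cong)
    also have "\<dots> = ennreal (exp (real k + 2)) * ennreal (prob {\<omega> \<in> space M. t < \<bar>U \<omega>\<bar>})"
      by (simp add: emeasure_eq_measure)
    also have "\<dots> \<le> ennreal (exp (real k + 2)) * ennreal (2 * exp (- (t\<^sup>2 / (2 * v))))"
      using tail[OF t(1)] by (intro mult_left_mono ennreal_leI) auto
    also have "\<dots> = ennreal (2 * exp (- real k))"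
      using v by (simp add: t(2) flip: ennreal_mult exp_add) (simp add: algebra_simps flip: exp_add)
    also have "exp (- real k) = exp (-1) ^ k"
      by (simp flip: exp_of_nat_mult)
    also have "ennreal (2 * exp (-1) ^ k) \<le> ennreal (2 * (1/2) ^ k)"
    proof (intro ennreal_leI mult_left_mono power_mono)
      show "exp (- 1) \<le> (1/2 :: real)"
        using exp_ge_add_one_self[of "1::real"] by (simp add: exp_minus field_simps)
    qed auto
    finally show "(\<integral>\<^sup>+\<omega>. ennreal (exp (real k + 2)) * indicator {real k + 1<..} (?y \<omega>) \<partial>M) \<le> ennreal (2 * (1/2) ^ k)" .
  qed auto
  also have "(\<Sum>k. ennreal (2 * (1/2) ^ k)) = ennreal 4"
    using sums_mult[OF geometric_sums[of "1/2::real"], of 2]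
    by (subst suminf_ennreal2) (auto simp: sums_iff)
  also have "ennreal (exp 1) + ennreal 4 = ennreal (exp 1 + 4)" by (rule ennreal_plus[symmetric]) auto
  also have "\<dots> \<le> ennreal 7" using exp_le by (intro ennreal_leI) auto
  finally show ?thesis .
qed

text \<open>For small \<open>\<theta>\<close> the linear term integrates to zero and convexity of the exponential scales the square
moment down to \<open>1 + O(\<theta>\<^sup>2)\<close>. For large \<open>\<theta>\<close> a cruder bound suffices: the arithmetic-geometric mean
inequality bounds \<open>\<theta> * U\<close> by \<open>\<theta>\<^sup>2 / (4 * a) + a * U\<^sup>2\<close>, and the constant \<open>7\<close> is absorbed in the
exponent.\<close>
lemma (in prob_space) mgf_le_of_exp_square_moment:
  assumes int: "integrable M U" and mean: "expectation U = 0" and a: "0 < a"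
    and sq: "(\<integral>\<^sup>+\<omega>. ennreal (exp (a * (U \<omega>)\<^sup>2)) \<partial>M) \<le> ennreal 7"
  shows "(\<integral>\<^sup>+\<omega>. ennreal (exp (\<theta> * U \<omega>)) \<partial>M) \<le> ennreal (exp (6 * \<theta>\<^sup>2 / a))"
proof -
  have [measurable]: "U \<in> borel_measurable M" using int by auto
  let ?Z = "\<lambda>\<omega>. exp (a * (U \<omega>)\<^sup>2)"
  have Z_int: "integrable M ?Z"
    using sq by (intro integrableI_nonneg) (auto intro: le_less_trans)
  have Z_le: "expectation ?Z \<le> 7"
  proof -
    have "ennreal (expectation ?Z) \<le> ennreal 7"
      using sq nn_integral_eq_integral[OF Z_int] by simp
    then show ?thesis by (subst (asm) ennreal_le_iff) auto
  qed
  have main: "(\<integral>\<^sup>+\<omega>. ennreal (exp (\<theta> * U \<omega>)) \<partial>M) \<le> ennreal B"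
    if "integrable M f" "\<And>\<omega>. exp (\<theta> * U \<omega>) \<le> f \<omega>" "expectation f \<le> B" for f B
  proof -
    have "(\<integral>\<^sup>+\<omega>. ennreal (exp (\<theta> * U \<omega>)) \<partial>M) \<le> (\<integral>\<^sup>+\<omega>. ennreal (f \<omega>) \<partial>M)"
      using that by (intro nn_integral_mono ennreal_leI)
    also have "\<dots> = ennreal (expectation f)"
      using that by (intro nn_integral_eq_integral) (auto intro: order_trans[OF exp_ge_zero])
    also have "\<dots> \<le> ennreal B" using that by (intro ennreal_leI)
    finally show ?thesis .
  qed
  \<comment> \<open>The ratio that separates small from large \<open>\<theta>\<close>.\<close>
  define \<eta> where "\<eta> = \<theta>\<^sup>2 / a"
  have \<eta>: "0 \<le> \<eta>" using a by (simp add: \<eta>_def)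
  show ?thesis
  proof (cases "\<eta> \<le> 1")
    case True
    show ?thesis
    proof (rule main)
      show "integrable M (\<lambda>\<omega>. \<theta> * U \<omega> + (1 + \<eta> * (?Z \<omega> - 1)))" using int Z_int by simp
      show "exp (\<theta> * U \<omega>) \<le> \<theta> * U \<omega> + (1 + \<eta> * (?Z \<omega> - 1))" for \<omega>
      proof -
        have "(\<theta> * U \<omega>)\<^sup>2 = \<eta> * (a * (U \<omega>)\<^sup>2)" using a by (simp add: \<eta>_def power_mult_distrib)
        then show ?thesis
          using exp_le_add_exp_sq[of "\<theta> * U \<omega>"] exp_convex_unit[OF \<eta> True, of "a * (U \<omega>)\<^sup>2"] by simp
      qed
      have "expectation (\<lambda>\<omega>. \<theta> * U \<omega> + (1 + \<eta> * (?Z \<omega> - 1))) = 1 + \<eta> * (expectation ?Z - 1)"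
        using int Z_int mean by (simp add: prob_space)
      also have "\<dots> \<le> 1 + \<eta> * 6" using Z_le \<eta> by (intro add_left_mono mult_left_mono) auto
      also have "\<dots> \<le> exp (6 * \<theta>\<^sup>2 / a)"
        using exp_ge_add_one_self[of "6 * \<theta>\<^sup>2 / a"] by (simp add: \<eta>_def mult.commute)
      finally show "expectation (\<lambda>\<omega>. \<theta> * U \<omega> + (1 + \<eta> * (?Z \<omega> - 1))) \<le> exp (6 * \<theta>\<^sup>2 / a)" .
    qed
  next
    case False
    show ?thesis
    proof (rule main)
      show "integrable M (\<lambda>\<omega>. exp (\<eta> / 4) * ?Z \<omega>)" using Z_int by simp
      show "exp (\<theta> * U \<omega>) \<le> exp (\<eta> / 4) * ?Z \<omega>" for \<omega>
      proof -
        have "0 \<le> (a * U \<omega> - \<theta> / 2)\<^sup>2 / a" using a by simp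
        also have "\<dots> = \<eta> / 4 + a * (U \<omega>)\<^sup>2 - \<theta> * U \<omega>"
          using a by (simp add: \<eta>_def power2_eq_square field_simps)
        finally show ?thesis by (simp flip: exp_add)
      qed
      have "expectation (\<lambda>\<omega>. exp (\<eta> / 4) * ?Z \<omega>) \<le> exp (\<eta> / 4) * 7"
        using Z_le by simp
      also have "\<dots> \<le> exp (\<eta> / 4) * exp (23/4 * \<eta>)"
      proof (intro mult_left_mono)
        have "(7::real) \<le> (1 + 23/8) ^ 2" by (simp add: power2_eq_square)
        also have "\<dots> \<le> exp (23/8) ^ 2"
          by (intro power_mono exp_ge_add_one_self) auto
        also have "\<dots> = exp (23/4)" by (simp flip: exp_of_nat_mult)
        also have "\<dots> \<le> exp (23/4 * \<eta>)" using False by simp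
        finally show "7 \<le> exp (23/4 * \<eta>)" .
      qed simp
      also have "\<dots> = exp (6 * \<theta>\<^sup>2 / a)" by (simp add: \<eta>_def flip: exp_add)
      finally show "expectation (\<lambda>\<omega>. exp (\<eta> / 4) * ?Z \<omega>) \<le> exp (6 * \<theta>\<^sup>2 / a)" .
    qed
  qed
qed

text \<open>Passing to a strictly larger parameter makes it positive and removes the degenerate case of a
variable that vanishes almost surely.\<close>
lemma subgaussian_tail_mono:
  assumes "subgaussian_tail M U v" and "v < v'" and "0 < t"
  shows "measure M {\<omega> \<in> space M. t < \<bar>U \<omega>\<bar>} \<le> 2 * exp (- (t\<^sup>2 / (2 * v')))"
proof (cases "v = 0")
  case True
  then have "measure M {\<omega> \<in> space M. t < \<bar>U \<omega>\<bar>} \<le> 0"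
    using assms by (auto simp: subgaussian_tail_def)
  also have "0 \<le> 2 * exp (- (t\<^sup>2 / (2 * v')))" by simp
  finally show ?thesis .
next
  case False
  then have "0 < v" using assms by (auto simp: subgaussian_tail_def)
  then have "t\<^sup>2 / (2 * v') \<le> t\<^sup>2 / (2 * v)" using assms by (intro divide_left_mono) auto
  then have "exp (- (t\<^sup>2 / (2 * v))) \<le> exp (- (t\<^sup>2 / (2 * v')))" by simp
  moreover have "measure M {\<omega> \<in> space M. t < \<bar>U \<omega>\<bar>} \<le> 2 * exp (- (t\<^sup>2 / (2 * v)))"
    using assms False by (auto simp: subgaussian_tail_def)
  ultimately show ?thesis by linarith
qed

lemma (in prob_space) subgaussian_mgf:
  assumes int: "integrable M U" and mean: "expectation U = 0"
    and "subgaussian_tail M U v" and "v < v'"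
  shows "(\<integral>\<^sup>+\<omega>. ennreal (exp (\<theta> * U \<omega>)) \<partial>M) \<le> ennreal (exp (24 * v' * \<theta>\<^sup>2))"
proof -
  have v': "0 < v'" using assms by (auto simp: subgaussian_tail_def)
  have "(\<integral>\<^sup>+\<omega>. ennreal (exp (1 / (4 * v') * (U \<omega>)\<^sup>2)) \<partial>M) \<le> ennreal 7"
    using exp_square_moment_le[OF _ v' subgaussian_tail_mono[OF assms(3,4)]] int by simp
  from mgf_le_of_exp_square_moment[OF int mean _ this, of \<theta>] v'
  show ?thesis by (simp add: algebra_simps)
qed

section \<open>Concentration of weighted sums\<close>

text \<open>Chernoff's method: independence turns the exponential moment of the sum into a product of Gaussian
type bounds, and the exponent is then minimized.\<close>
lemma (in prob_space) weighted_sum_upper_tail: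
  assumes indep: "indep_vars (\<lambda>_. borel) w I" and fin: "finite I"
    and mgf: "\<And>i \<theta>. i \<in> I \<Longrightarrow> (\<integral>\<^sup>+\<omega>. ennreal (exp (\<theta> * w i \<omega>)) \<partial>M) \<le> ennreal (exp (b * \<theta>\<^sup>2))"
    and b: "0 < b" and V: "0 < V" "(\<Sum>i\<in>I. (x i)\<^sup>2) \<le> V" and t: "0 < t"
  shows "prob {\<omega> \<in> space M. t \<le> (\<Sum>i\<in>I. x i * w i \<omega>)} \<le> exp (- (t\<^sup>2 / (4 * b * V)))"
proof -
  have [measurable]: "w i \<in> borel_measurable M" if "i \<in> I" for i
    using indep that by (auto simp: indep_vars_def)
  \<comment> \<open>The minimizer of \<open>b * l\<^sup>2 * V - l * t\<close>.\<close>
  define l where "l = t / (2 * b * V)"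
  have l: "0 < l" using t b V by (simp add: l_def)
  have "ennreal (prob {\<omega> \<in> space M. t \<le> (\<Sum>i\<in>I. x i * w i \<omega>)})
     = emeasure M {\<omega> \<in> space M. t \<le> (\<Sum>i\<in>I. x i * w i \<omega>)}"
    by (simp add: emeasure_eq_measure)
  also have "\<dots> \<le> ennreal (exp (- l * t)) * (\<integral>\<^sup>+\<omega>\<in>space M. exp (l * (\<Sum>i\<in>I. x i * w i \<omega>)) \<partial>M)"
    by (intro Chernoff_ineq_nn_integral_ge l) auto
  also have "(\<integral>\<^sup>+\<omega>\<in>space M. exp (l * (\<Sum>i\<in>I. x i * w i \<omega>)) \<partial>M)
     = (\<integral>\<^sup>+\<omega>. (\<Prod>i\<in>I. ennreal (exp ((l * x i) * w i \<omega>))) \<partial>M)"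
    by (intro nn_integral_cong) (simp_all add: sum_distrib_left exp_sum fin prod_ennreal mult.assoc)
  also have "\<dots> = (\<Prod>i\<in>I. \<integral>\<^sup>+\<omega>. ennreal (exp ((l * x i) * w i \<omega>)) \<partial>M)"
    by (intro indep_vars_nn_integral fin indep_vars_compose2[OF indep]) auto
  also have "ennreal (exp (- l * t)) * \<dots> \<le> ennreal (exp (- l * t)) * (\<Prod>i\<in>I. ennreal (exp (b * (l * x i)\<^sup>2)))"
    using mgf by (intro mult_left_mono prod_mono_ennreal) auto
  also have "\<dots> = ennreal (exp (- l * t + b * l\<^sup>2 * (\<Sum>i\<in>I. (x i)\<^sup>2)))"
  proof -
    have "(\<Prod>i\<in>I. exp (b * (l * x i)\<^sup>2)) = exp (b * l\<^sup>2 * (\<Sum>i\<in>I. (x i)\<^sup>2))"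
      by (simp add: exp_sum fin sum_distrib_left power_mult_distrib mult.assoc)
    then show ?thesis by (simp add: prod_ennreal mult_exp_exp flip: ennreal_mult)
  qed
  also have "\<dots> \<le> ennreal (exp (- (t\<^sup>2 / (4 * b * V))))"
  proof -
    have "b * l\<^sup>2 * (\<Sum>i\<in>I. (x i)\<^sup>2) \<le> b * l\<^sup>2 * V" using b V by (intro mult_left_mono) auto
    moreover have "- l * t + b * l\<^sup>2 * V = - (t\<^sup>2 / (4 * b * V))"
      using b V by (simp add: l_def field_simps power2_eq_square)
    ultimately show ?thesis by (intro ennreal_leI) simp
  qed
  finally show ?thesis by simp
qed

lemma (in prob_space) weighted_sum_tail:
  assumes indep: "indep_vars (\<lambda>_. borel) w I" and fin: "finite I"
    and mgf: "\<And>i \<theta>. i \<in> I \<Longrightarrow> (\<integral>\<^sup>+\<omega>. ennreal (exp (\<theta> * w i \<omega>)) \<partial>M) \<le> ennreal (exp (b * \<theta>\<^sup>2))"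
    and b: "0 < b" and V: "0 < V" "(\<Sum>i\<in>I. (x i)\<^sup>2) \<le> V" and t: "0 < t"
  shows "prob {\<omega> \<in> space M. t \<le> \<bar>\<Sum>i\<in>I. x i * w i \<omega>\<bar>} \<le> 2 * exp (- (t\<^sup>2 / (4 * b * V)))"
proof -
  have [measurable]: "w i \<in> borel_measurable M" if "i \<in> I" for i
    using indep that by (auto simp: indep_vars_def)
  have "{\<omega> \<in> space M. t \<le> \<bar>\<Sum>i\<in>I. x i * w i \<omega>\<bar>}
    = {\<omega> \<in> space M. t \<le> (\<Sum>i\<in>I. x i * w i \<omega>)} \<union> {\<omega> \<in> space M. t \<le> (\<Sum>i\<in>I. - x i * w i \<omega>)}"
    by (auto simp: sum_negf)
  also have "prob \<dots> \<le> prob {\<omega> \<in> space M. t \<le> (\<Sum>i\<in>I. x i * w i \<omega>)} + prob {\<omega> \<in> space M. t \<le> (\<Sum>i\<in>I. - x i * w i \<omega>)}"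
    by (intro measure_Un_le) auto
  also have "\<dots> \<le> exp (- (t\<^sup>2 / (4 * b * V))) + exp (- (t\<^sup>2 / (4 * b * V)))"
    using weighted_sum_upper_tail[OF indep fin mgf b V t]
      weighted_sum_upper_tail[OF indep fin mgf b V(1) _ t, of "\<lambda>i. - x i"] V(2)
    by (intro add_mono) auto
  finally show ?thesis by simp
qed

section \<open>Matrix norms and entries\<close>

lemma mat_inf_norm_nonneg: "0 \<le> mat_inf_norm K"
  unfolding mat_inf_norm_def by (intro Max_ge) auto

lemma row_sum_le_mat_inf_norm:
  assumes "i < dim_row K"
  shows "(\<Sum>j<dim_col K. \<bar>K $$ (i, j)\<bar>) \<le> mat_inf_norm K"
  unfolding mat_inf_norm_def using assms by (intro Max_ge) auto

lemma abs_row_mult_le: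
  assumes i: "i < dim_row K" and u: "\<And>j. j < dim_col K \<Longrightarrow> \<bar>u j\<bar> \<le> \<tau>" and \<tau>: "0 \<le> \<tau>"
  shows "\<bar>\<Sum>j<dim_col K. K $$ (i, j) * u j\<bar> \<le> mat_inf_norm K * \<tau>"
proof -
  have "\<bar>\<Sum>j<dim_col K. K $$ (i, j) * u j\<bar> \<le> (\<Sum>j<dim_col K. \<bar>K $$ (i, j) * u j\<bar>)" by (rule sum_abs)
  also have "\<dots> \<le> (\<Sum>j<dim_col K. \<bar>K $$ (i, j)\<bar> * \<tau>)"
    using u by (intro sum_mono) (auto simp: abs_mult intro!: mult_left_mono)
  also have "\<dots> \<le> mat_inf_norm K * \<tau>"
    using mult_right_mono[OF row_sum_le_mat_inf_norm[OF i] \<tau>] by (simp add: sum_distrib_right)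
  finally show ?thesis .
qed

lemma finite_abs_entries: "finite {\<bar>K $$ (i, j)\<bar> | i j. i < dim_row K \<and> j < dim_col K}"
proof -
  have "{\<bar>K $$ (i, j)\<bar> | i j. i < dim_row K \<and> j < dim_col K}
    = (\<lambda>(i, j). \<bar>K $$ (i, j)\<bar>) ` ({..<dim_row K} \<times> {..<dim_col K})" by auto
  then show ?thesis by simp
qed

lemma abs_entry_le_mat_max_norm:
  assumes "i < dim_row K" "j < dim_col K"
  shows "\<bar>K $$ (i, j)\<bar> \<le> mat_max_norm K"
  unfolding mat_max_norm_def using finite_abs_entries[of K] assms by (intro Max_ge) auto

lemma mat_max_norm_le:
  assumes "0 \<le> c" "\<And>i j. i < dim_row K \<Longrightarrow> j < dim_col K \<Longrightarrow> \<bar>K $$ (i, j)\<bar> \<le> c"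
  shows "mat_max_norm K \<le> c"
  unfolding mat_max_norm_def using finite_abs_entries[of K] assms by (subst Max_le_iff) auto

lemma vec_inf_norm_le:
  assumes "0 \<le> c" "\<And>i. i < dim_vec v \<Longrightarrow> \<bar>v $ i\<bar> \<le> c"
  shows "vec_inf_norm v \<le> c"
  unfolding vec_inf_norm_def using assms by (subst Max_le_iff) auto

lemma mult_mat_vec_entry:
  assumes "A \<in> carrier_mat m k" "v \<in> carrier_vec k" "i < m"
  shows "(A *\<^sub>v v) $ i = (\<Sum>j<k. A $$ (i, j) * v $ j)"
  using assms by (auto simp: scalar_prod_def atLeast0LessThan intro!: sum.cong)

lemma scalar_prod_sum:
  assumes "v \<in> carrier_vec k"
  shows "u \<bullet> v = (\<Sum>i<k. u $ i * v $ i)"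
  using assms by (auto simp: scalar_prod_def atLeast0LessThan)

lemma quad_form_mat:
  assumes "A \<in> carrier_mat p p" "v \<in> carrier_vec p"
  shows "v \<bullet> (A *\<^sub>v v) = quad_form p (\<lambda>i j. A $$ (i, j)) (\<lambda>i. v $ i)"
proof -
  have "A *\<^sub>v v \<in> carrier_vec p" using assms by auto
  then show ?thesis
    using assms by (simp add: scalar_prod_sum[of _ p] mult_mat_vec_entry quad_form_def del: index_mult_mat_vec)
qed

lemma quad_form_cong: "(\<And>i. i < p \<Longrightarrow> x i = y i) \<Longrightarrow> quad_form p A x = quad_form p A y"
  by (simp add: quad_form_def)

lemma lasso_cong: "(\<And>i. i < p \<Longrightarrow> x i = y i) \<Longrightarrow> lasso p A r l x = lasso p A r l y"
  by (simp add: lasso_def cong: quad_form_cong)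

text \<open>Test vectors are arbitrary functions here; only their first \<open>p\<close> values matter.\<close>
lemma pos_semidef_mat:
  assumes "psd_mat p A"
  shows "pos_semidef p (\<lambda>i j. A $$ (i, j))"
  unfolding pos_semidef_def
proof (intro conjI allI impI)
  fix i j assume "i < p" "j < p"
  then show "A $$ (i, j) = A $$ (j, i)"
    using assms unfolding psd_mat_def by (metis carrier_matD index_transpose_mat(1))
next
  fix x :: "nat \<Rightarrow> real"
  have A: "A \<in> carrier_mat p p" using assms by (simp add: psd_mat_def)
  have "0 \<le> vec p x \<bullet> (A *\<^sub>v vec p x)" using assms unfolding psd_mat_def by auto
  also have "\<dots> = quad_form p (\<lambda>i j. A $$ (i, j)) (\<lambda>i. vec p x $ i)"
    using A by (intro quad_form_mat) auto
  also have "\<dots> = quad_form p (\<lambda>i j. A $$ (i, j)) x" by (rule quad_form_cong) simp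
  finally show "0 \<le> quad_form p (\<lambda>i j. A $$ (i, j)) x" .
qed

lemma cocolasso_objective_eq_lasso:
  assumes "A \<in> carrier_mat p p" "b \<in> carrier_vec p"
  shows "cocolasso_objective A r l b = lasso p (\<lambda>i j. A $$ (i, j)) (\<lambda>i. r $ i) l (\<lambda>i. b $ i)"
  using assms unfolding cocolasso_objective_def lasso_def quad_form_mat[OF assms] vec_l1_norm_def
  by (simp add: scalar_prod_sum[of _ p])

lemma Sigma_mat_carrier: "X \<in> carrier_mat n p \<Longrightarrow> Sigma_mat X \<in> carrier_mat p p"
  by (auto simp: Sigma_mat_def)

lemma smult_mult_mat_vec:
  fixes A :: "real mat"
  assumes "A \<in> carrier_mat m k" "v \<in> carrier_vec k"
  shows "(c \<cdot>\<^sub>m A) *\<^sub>v v = c \<cdot>\<^sub>v (A *\<^sub>v v)"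
  using assms by (intro eq_vecI) (auto simp: scalar_prod_def sum_distrib_left mult.assoc)

lemma Sigma_mat_psd:
  assumes X: "X \<in> carrier_mat n p"
  shows "psd_mat p (Sigma_mat X)"
  unfolding psd_mat_def
proof (intro conjI ballI)
  show "Sigma_mat X \<in> carrier_mat p p" by (rule Sigma_mat_carrier[OF X])
  show "transpose_mat (Sigma_mat X) = Sigma_mat X"
    using X by (intro eq_matI) (auto simp: Sigma_mat_def scalar_prod_def mult.commute)
  fix v :: "real vec" assume v: "v \<in> carrier_vec p"
  have Xv: "X *\<^sub>v v \<in> carrier_vec n" using X v by auto
  have "Sigma_mat X *\<^sub>v v = (1 / real n) \<cdot>\<^sub>v (transpose_mat X * X *\<^sub>v v)"
    using X v by (simp add: Sigma_mat_def smult_mult_mat_vec[of _ p p])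
  then have "v \<bullet> (Sigma_mat X *\<^sub>v v) = (1 / real n) * (v \<bullet> (transpose_mat X *\<^sub>v (X *\<^sub>v v)))"
    using X v by (simp add: assoc_mult_mat_vec[of _ p n _ p])
  also have "v \<bullet> (transpose_mat X *\<^sub>v (X *\<^sub>v v)) = (X *\<^sub>v v) \<bullet> (X *\<^sub>v v)"
    using X v Xv by (metis comm_scalar_prod transpose_vec_mult_scalar mult_mat_vec_carrier transpose_carrier_mat)
  finally show "0 \<le> v \<bullet> (Sigma_mat X *\<^sub>v v)"
    by (simp add: scalar_prod_def sum_nonneg)
qed

text \<open>Since \<open>S\<close> itself competes in the projection, the projection of \<open>H\<close> is no farther from \<open>H\<close> than \<open>S\<close> is,
and the triangle inequality costs a factor two.\<close>
lemma nearest_psd_entry_le: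
  assumes near: "nearest_psd p H A" and S: "psd_mat p S" and H: "H \<in> carrier_mat p p"
    and d: "\<And>i j. i < p \<Longrightarrow> j < p \<Longrightarrow> \<bar>H $$ (i, j) - S $$ (i, j)\<bar> \<le> d" and d0: "0 \<le> d"
    and ij: "i < p" "j < p"
  shows "\<bar>A $$ (i, j) - S $$ (i, j)\<bar> \<le> 2 * d"
proof -
  have A: "psd_mat p A" using near by (auto simp: nearest_psd_def is_arg_min_def)
  then have carr: "A \<in> carrier_mat p p" "S \<in> carrier_mat p p" using S by (auto simp: psd_mat_def)
  have "\<bar>(H - A) $$ (i, j)\<bar> \<le> mat_max_norm (H - A)"
    using ij carr H by (intro abs_entry_le_mat_max_norm) auto
  also have "\<dots> \<le> mat_max_norm (H - S)"
    using near S by (auto simp: nearest_psd_def is_arg_min_def not_less)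
  also have "\<dots> \<le> d"
    using carr H d d0 by (intro mat_max_norm_le) auto
  finally have "\<bar>H $$ (i, j) - A $$ (i, j)\<bar> \<le> d" using ij carr H by simp
  then show ?thesis using d[OF ij] by linarith
qed

section \<open>Blocks and inverses\<close>

lemma pick_lessThan: "i < s \<Longrightarrow> pick {..<s} i = i"
  using pick_card_in_set[of i "{..<s}"] by (simp add: Collect_conj_eq Int_absorb1 subset_eq lessThan_def[symmetric])

lemma pick_atLeastLessThan: 
  assumes "i < p - s" shows "pick {s..<p} i = s + i"
proof -
  have "{a \<in> {s..<p}. a < s + i} = {s..<s + i}" using assms by auto
  then have "card {a \<in> {s..<p}. a < s + i} = i" by simp
  then show ?thesis using pick_card_in_set[of "s + i" "{s..<p}"] assms by simp
qed

lemma submatrix_leading: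
  assumes "K \<in> carrier_mat p p" "s \<le> p"
  shows "submatrix K {..<s} {..<s} = mat s s (\<lambda>(i, j). K $$ (i, j))"
proof -
  have "{i. i < p \<and> i \<in> {..<s}} = {..<s}" using assms by auto
  then have "card {i. i < p \<and> i \<in> {..<s}} = s" by simp
  then show ?thesis
    using assms by (intro eq_matI) (auto simp: submatrix_def pick_lessThan)
qed

lemma submatrix_trailing_rows:
  assumes "K \<in> carrier_mat p p" "s \<le> p"
  shows "submatrix K {s..<p} {..<s} = mat (p - s) s (\<lambda>(i, j). K $$ (s + i, j))"
proof -
  have "{i. i < p \<and> i \<in> {..<s}} = {..<s}" "{i. i < p \<and> i \<in> {s..<p}} = {s..<p}" using assms by auto
  then have "card {i. i < p \<and> i \<in> {..<s}} = s" "card {i. i < p \<and> i \<in> {s..<p}} = p - s" by simp_all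
  then show ?thesis
    using assms by (intro eq_matI) (auto simp: submatrix_def pick_lessThan pick_atLeastLessThan)
qed

text \<open>A singular matrix has the eigenvalue \<open>0\<close>, so its smallest eigenvalue cannot be positive. Finiteness of
the set of eigenvalues, the roots of the characteristic polynomial, gives \<open>min_eigenvalue\<close> its meaning.\<close>
lemma min_eigenvalue_pos_inverse:
  assumes K: "K \<in> carrier_mat s s" and pos: "0 < min_eigenvalue K"
  shows "the (mat_inverse K) \<in> carrier_mat s s" and "the (mat_inverse K) * K = 1\<^sub>m s"
proof -
  have "char_poly K \<noteq> 0" using degree_monic_char_poly[OF K] by auto
  then have fin: "finite {k. eigenvalue K k}"
    using poly_roots_finite by (simp add: eigenvalue_root_char_poly[OF K])
  have "\<not> eigenvalue K 0"
  proof
    assume "eigenvalue K 0"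
    then have "Min {k. eigenvalue K k} \<le> 0" using fin by (intro Min_le) auto
    then show False using pos by (simp add: min_eigenvalue_def)
  qed
  then have "det K \<noteq> 0"
  proof -
    have "0 \<cdot>\<^sub>v v = 0\<^sub>v s" if "v \<in> carrier_vec s" for v :: "real vec"
      using that by auto
    then show ?thesis
      using K \<open>\<not> eigenvalue K 0\<close> unfolding det_0_iff_vec_prod_zero[OF K] eigenvalue_def eigenvector_def
      by (metis carrier_matD(1))
  qed
  then have "K \<in> Units (ring_mat TYPE(real) s ())" by (rule det_non_zero_imp_unit[OF K])
  then obtain B where "mat_inverse K = Some B"
    using mat_inverse(1)[OF K, where b = "()"] by (cases "mat_inverse K") auto
  then show "the (mat_inverse K) \<in> carrier_mat s s" and "the (mat_inverse K) * K = 1\<^sub>m s"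
    using mat_inverse(2)[OF K] by auto
qed

lemma mult_mat_row_sum:
  assumes "A \<in> carrier_mat m k" "B \<in> carrier_mat k q" "i < m"
  shows "(\<Sum>j<q. (A * B) $$ (i, j) * x j) = (\<Sum>h<k. A $$ (i, h) * (\<Sum>j<q. B $$ (h, j) * x j))"
proof -
  have "(\<Sum>j<q. (A * B) $$ (i, j) * x j) = (\<Sum>j<q. \<Sum>h<k. A $$ (i, h) * B $$ (h, j) * x j)"
    using assms by (intro sum.cong) (auto simp: scalar_prod_def atLeast0LessThan sum_distrib_right)
  also have "\<dots> = (\<Sum>h<k. \<Sum>j<q. A $$ (i, h) * B $$ (h, j) * x j)" by (rule sum.swap)
  finally show ?thesis by (simp add: sum_distrib_left mult.assoc)
qed

lemma inv_bound_of_inverse: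
  assumes K: "\<And>i j. i < s \<Longrightarrow> j < s \<Longrightarrow> K $$ (i, j) = F i j" "K \<in> carrier_mat s s"
    and B: "B \<in> carrier_mat s s" "B * K = 1\<^sub>m s" 
  shows "inv_bound s F (mat_inf_norm B)"
  unfolding inv_bound_def
proof (intro allI impI)
  fix x :: "nat \<Rightarrow> real" and \<tau> k
  assume \<tau>: "\<forall>i<s. \<bar>\<Sum>j<s. F i j * x j\<bar> \<le> \<tau>" and k: "k < s"
  have "x k = (\<Sum>j<s. (1\<^sub>m s) $$ (k, j) * x j)"
    using k by (simp add: if_distrib[of "\<lambda>z. z * _"] cong: if_cong)
  also have "\<dots> = (\<Sum>h<s. B $$ (k, h) * (\<Sum>j<s. K $$ (h, j) * x j))"
    unfolding B(2)[symmetric] by (rule mult_mat_row_sum[OF B(1) K(2) k])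
  also have "\<dots> = (\<Sum>h<dim_col B. B $$ (k, h) * (\<Sum>j<s. F h j * x j))"
    using K B by simp
  finally have "x k = \<dots>" .
  moreover have "0 \<le> \<tau>" using \<tau> k by (meson abs_ge_zero order_trans)
  ultimately show "\<bar>x k\<bar> \<le> mat_inf_norm B * \<tau>"
    using abs_row_mult_le[of k B "\<lambda>h. \<Sum>j<s. F h j * x j" \<tau>] \<tau> k B by simp
qed

text \<open>The trailing rows \<open>L\<close> of \<open>S\<close> satisfy \<open>L x = (L B) (K x)\<close> with \<open>B\<close> the inverse of the leading block
\<open>K\<close>, so the maximum absolute row sum of \<open>L B\<close> compares their action with that of the leading rows.\<close>
lemma irrepresentable_rows:
  assumes S: "S \<in> carrier_mat p p" and sp: "s \<le> p" and s: "0 < s"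
    and B: "B \<in> carrier_mat s s" "B * submatrix S {..<s} {..<s} = 1\<^sub>m s"
    and u: "\<And>i. i < s \<Longrightarrow> \<bar>\<Sum>k<s. S $$ (i, k) * x k\<bar> \<le> \<tau>" and j: "s \<le> j" "j < p"
  shows "\<bar>\<Sum>k<s. S $$ (j, k) * x k\<bar> \<le> mat_inf_norm (submatrix S {s..<p} {..<s} * B) * \<tau>"
proof -
  define K where "K = mat s s (\<lambda>(i, j). S $$ (i, j))"
  define L where "L = mat (p - s) s (\<lambda>(i, j). S $$ (s + i, j))"
  have carr: "K \<in> carrier_mat s s" "L \<in> carrier_mat (p - s) s" by (auto simp: K_def L_def)
  have BK: "B * K = 1\<^sub>m s" using B(2) by (simp add: submatrix_leading[OF S sp] K_def)
  have W: "L * B \<in> carrier_mat (p - s) s" using carr B by auto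
  have "L * B * K = L"
    using carr B BK by (simp add: assoc_mult_mat[of L _ s B s K s])
  then have "(\<Sum>k<s. L $$ (j - s, k) * x k) = (\<Sum>h<s. (L * B) $$ (j - s, h) * (\<Sum>k<s. K $$ (h, k) * x k))"
    using mult_mat_row_sum[OF W carr(1), of "j - s" x] j by simp
  moreover have "(\<Sum>k<s. L $$ (j - s, k) * x k) = (\<Sum>k<s. S $$ (j, k) * x k)"
    using j by (auto simp: L_def)
  moreover have "\<bar>\<Sum>h<dim_col (L * B). (L * B) $$ (j - s, h) * (\<Sum>k<s. K $$ (h, k) * x k)\<bar> \<le> mat_inf_norm (L * B) * \<tau>"
  proof (rule abs_row_mult_le)
    show "j - s < dim_row (L * B)" using W j by (auto simp: L_def)
    show "\<bar>\<Sum>k<s. K $$ (h, k) * x k\<bar> \<le> \<tau>" if "h < dim_col (L * B)" for h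
      using u[of h] that B by (simp add: K_def)
    show "0 \<le> \<tau>" using u[OF s] by (meson abs_ge_zero order_trans)
  qed
  ultimately show ?thesis
    using W B by (simp add: submatrix_trailing_rows[OF S sp] L_def[symmetric])
qed

section \<open>Recovery for surrogates close to their targets\<close>

lemma sgn_eq_of_close:
  fixes x y :: real
  assumes "\<bar>x - y\<bar> < \<bar>y\<bar>"
  shows "sgn x = sgn y"
  using assms by (auto simp: sgn_if abs_if split: if_splits)

text \<open>The witness theorem for arrays, translated to matrices. The error bound from the inverse alone is
\<open>4 * mat_inf_norm B * l\<close>; the term \<open>min_eigenvalue K powr (- 1 / 2)\<close> in \<open>\<kappa>\<close> makes the bound strict, which
is what sign recovery needs when an entry of \<open>\<beta>\<close> has absolute value exactly \<open>\<kappa> * l\<close>.\<close>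
lemma cocolasso_recovery_if_close:
  fixes S A :: "real mat" and \<beta> r :: "real vec" and s p :: nat
  defines "K \<equiv> submatrix S {..<s} {..<s}"
  defines "B \<equiv> the (mat_inverse K)"
  defines "\<kappa> \<equiv> 4 * mat_inf_norm B + min_eigenvalue K powr (- 1 / 2)"
  assumes S: "S \<in> carrier_mat p p" and sp: "s \<le> p" and s: "0 < s"
    and irrep: "mat_inf_norm (submatrix S {s..<p} {..<s} * B) = 1 - \<gamma>" and \<gamma>: "0 < \<gamma>"
    and eig: "0 < min_eigenvalue K"
    and A: "psd_mat p A"
    and d: "\<And>i j. i < p \<Longrightarrow> j < p \<Longrightarrow> \<bar>A $$ (i, j) - S $$ (i, j)\<bar> \<le> d"
    and d_small: "16 * d * real s * mat_inf_norm B \<le> \<gamma>"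
    and \<beta>: "\<beta> \<in> carrier_vec p"
    and e: "\<And>i. i < p \<Longrightarrow> \<bar>r $ i - (\<Sum>k<s. S $$ (i, k) * \<beta> $ k)\<bar> \<le> e"
    and e_small: "e + d * vec_l1_norm (vec_first \<beta> s) \<le> \<gamma> * l / 8" and l: "0 < l"
  shows "(\<exists>!b. cocolasso_minimizer p A r l b) \<and>
    (\<forall>b. cocolasso_minimizer p A r l b \<longrightarrow>
      (\<forall>j<p. b $ j \<noteq> 0 \<longrightarrow> j < s) \<and>
      vec_inf_norm (vec_first b s - vec_first \<beta> s) \<le> \<kappa> * l \<and>
      (Min ((\<lambda>j. \<bar>\<beta> $ j\<bar>) ` {..<s}) \<ge> \<kappa> * l \<longrightarrow> (\<forall>j<s. sgn (b $ j) = sgn (\<beta> $ j))))"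
proof -
  let ?A = "\<lambda>i j. A $$ (i, j)" and ?S = "\<lambda>i j. S $$ (i, j)"
  have K: "K = mat s s (\<lambda>(i, j). S $$ (i, j))" unfolding K_def by (rule submatrix_leading[OF S sp])
  then have K_carr: "K \<in> carrier_mat s s" by simp
  note B = min_eigenvalue_pos_inverse[OF K_carr eig, folded B_def]
  have inv: "inv_bound s ?S (mat_inf_norm B)"
    by (rule inv_bound_of_inverse[OF _ K_carr B]) (simp add: K)
  have A_carr: "A \<in> carrier_mat p p" using A by (simp add: psd_mat_def)
  have \<gamma>1: "\<gamma> \<le> 1" using irrep mat_inf_norm_nonneg by (metis diff_ge_0_iff_ge)
  have l1: "vec_l1_norm (vec_first \<beta> s) = (\<Sum>k<s. \<bar>\<beta> $ k\<bar>)"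
    by (simp add: vec_l1_norm_def vec_first_def)
  have rows: "\<bar>\<Sum>k<s. S $$ (j, k) * x k\<bar> \<le> (1 - \<gamma>) * \<tau>"
    if "\<And>i. i < s \<Longrightarrow> \<bar>\<Sum>k<s. S $$ (i, k) * x k\<bar> \<le> \<tau>" "s \<le> j" "j < p" for x \<tau> j
    using irrepresentable_rows[OF S sp s B[unfolded K_def] that] irrep by simp
  obtain x where supp: "\<And>i. s \<le> i \<Longrightarrow> x i = 0"
    and err: "\<And>k. k < s \<Longrightarrow> \<bar>x k - \<beta> $ k\<bar> \<le> 4 * mat_inf_norm B * l"
    and opt: "\<And>y. lasso p ?A (\<lambda>i. r $ i) l x \<le> lasso p ?A (\<lambda>i. r $ i) l y"
    and uniq: "\<And>y i. lasso p ?A (\<lambda>i. r $ i) l y \<le> lasso p ?A (\<lambda>i. r $ i) l x \<Longrightarrow> i < p \<Longrightarrow> y i = x i"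
    using lasso_support_recovery[where A = ?A and K = ?S and r = "\<lambda>i. r $ i" and \<beta> = "\<lambda>i. \<beta> $ i" and p = p and s = s
        and N = "mat_inf_norm B" and \<gamma> = \<gamma> and d = d and e = e and l = l,
        OF pos_semidef_mat[OF A] sp inv mat_inf_norm_nonneg rows \<gamma> \<gamma>1 d d_small e e_small[unfolded l1] l s]
    by blast
  define b0 where "b0 = vec p x"
  have b0: "b0 \<in> carrier_vec p" by (simp add: b0_def)
  have obj: "cocolasso_objective A r l b = lasso p ?A (\<lambda>i. r $ i) l (\<lambda>i. b $ i)" if "b \<in> carrier_vec p" for b
    by (rule cocolasso_objective_eq_lasso[OF A_carr that])
  have obj0: "cocolasso_objective A r l b0 = lasso p ?A (\<lambda>i. r $ i) l x"
    unfolding obj[OF b0] by (rule lasso_cong) (simp add: b0_def)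
  have min0: "cocolasso_minimizer p A r l b0"
    unfolding cocolasso_minimizer_def is_arg_min_def using b0 opt obj obj0 by (auto simp: not_less)
  have only: "b = b0" if "cocolasso_minimizer p A r l b" for b
  proof -
    have b: "b \<in> carrier_vec p" and "cocolasso_objective A r l b \<le> cocolasso_objective A r l b0"
      using that b0 by (auto simp: cocolasso_minimizer_def is_arg_min_def not_less)
    then have "b $ i = x i" if "i < p" for i
      using uniq[of "\<lambda>i. b $ i"] that obj[OF b] obj0 by simp
    then show ?thesis using b by (intro eq_vecI) (auto simp: b0_def)
  qed
  have \<kappa>: "4 * mat_inf_norm B * l < \<kappa> * l"
    using l eig by (simp add: \<kappa>_def)
  have "0 \<le> \<kappa> * l" using \<kappa> mat_inf_norm_nonneg[of B] l by (smt (verit) mult_nonneg_nonneg)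
  then have "vec_inf_norm (vec_first b0 s - vec_first \<beta> s) \<le> \<kappa> * l"
    using err \<kappa> sp by (intro vec_inf_norm_le) (fastforce simp: vec_first_def b0_def)+
  moreover have "sgn (b0 $ j) = sgn (\<beta> $ j)"
    if "\<kappa> * l \<le> Min ((\<lambda>j. \<bar>\<beta> $ j\<bar>) ` {..<s})" "j < s" for j
  proof (rule sgn_eq_of_close)
    have "Min ((\<lambda>j. \<bar>\<beta> $ j\<bar>) ` {..<s}) \<le> \<bar>\<beta> $ j\<bar>" using that by (intro Min_le) auto
    moreover have "b0 $ j = x j" using that sp by (simp add: b0_def)
    ultimately show "\<bar>b0 $ j - \<beta> $ j\<bar> < \<bar>\<beta> $ j\<bar>"
      using err[OF that(2)] \<kappa> that(1) by linarith
  qed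
  moreover have "j < s" if "j < p" "b0 $ j \<noteq> 0" for j
    using that supp[of j] by (auto simp: b0_def not_less[symmetric])
  ultimately show ?thesis using min0 only by blast
qed

text \<open>The population counterpart of \<open>rho_vec\<close> is \<open>\<Sigma> \<beta>\<close>; the remainder is the correlation of a column of the
design with the noise.\<close>
lemma rho_vec_response:
  assumes X: "X \<in> carrier_mat n p" and \<beta>: "\<beta> \<in> carrier_vec p" and sp: "s \<le> p"
    and supp: "\<And>j. j < p \<Longrightarrow> s \<le> j \<Longrightarrow> \<beta> $ j = 0" and j: "j < p"
  shows "rho_vec X (response X \<beta> w \<omega>) $ j =
    (\<Sum>k<s. Sigma_mat X $$ (j, k) * \<beta> $ k) + (\<Sum>i<n. X $$ (i, j) / real n * w i \<omega>)"
proof -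
  have "(transpose_mat X *\<^sub>v response X \<beta> w \<omega>) $ j
    = (\<Sum>i<n. X $$ (i, j) * ((X *\<^sub>v \<beta>) $ i + w i \<omega>))"
    using X j by (simp add: response_def scalar_prod_def atLeast0LessThan)
  also have "\<dots> = (\<Sum>i<n. X $$ (i, j) * (X *\<^sub>v \<beta>) $ i) + (\<Sum>i<n. X $$ (i, j) * w i \<omega>)"
    by (simp add: distrib_left sum.distrib)
  also have "(\<Sum>i<n. X $$ (i, j) * (X *\<^sub>v \<beta>) $ i) = (\<Sum>i<n. transpose_mat X $$ (j, i) * (\<Sum>k<p. X $$ (i, k) * \<beta> $ k))"
    using X \<beta> j by (intro sum.cong) (auto simp: mult_mat_vec_entry simp del: index_mult_mat_vec)
  also have "\<dots> = (\<Sum>k<p. (transpose_mat X * X) $$ (j, k) * \<beta> $ k)"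
    using X j by (intro mult_mat_row_sum[symmetric]) auto
  also have "\<dots> = (\<Sum>k<s. (transpose_mat X * X) $$ (j, k) * \<beta> $ k)"
    using sp supp by (intro sum_supported) auto
  finally have "rho_vec X (response X \<beta> w \<omega>) $ j
    = (\<Sum>k<s. (1 / real n) * (transpose_mat X * X) $$ (j, k) * \<beta> $ k) + (\<Sum>i<n. X $$ (i, j) / real n * w i \<omega>)"
    using X j by (simp add: rho_vec_def add_divide_distrib sum_divide_distrib
        del: index_mult_mat_vec index_mult_mat(1))
  also have "(\<Sum>k<s. (1 / real n) * (transpose_mat X * X) $$ (j, k) * \<beta> $ k) = (\<Sum>k<s. Sigma_mat X $$ (j, k) * \<beta> $ k)"
    using X j sp by (intro sum.cong) (auto simp: Sigma_mat_def simp del: index_mult_mat(1))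
  finally show ?thesis .
qed

section \<open>Probability of the good event\<close>

lemma (in prob_space) prob_finite_union_le:
  assumes "finite I" "\<And>i. i \<in> I \<Longrightarrow> A i \<in> events" "\<And>i. i \<in> I \<Longrightarrow> prob (A i) \<le> a"
  shows "prob (\<Union>i\<in>I. A i) \<le> real (card I) * a"
proof -
  have "prob (\<Union>i\<in>I. A i) \<le> (\<Sum>i\<in>I. prob (A i))"
    using assms by (intro measure_UNION_le) auto
  also have "\<dots> \<le> (\<Sum>i\<in>I. a)" using assms by (intro sum_mono)
  finally show ?thesis by simp
qed

text \<open>A union bound over \<open>p\<^sup>2 + 2 * p\<close> events. The linear counts are majorized by \<open>p\<^sup>2\<close>, which produces the
constant \<open>2 * C + 2\<close>.\<close>
lemma (in prob_space) prob_all_small_ge: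
  fixes H :: "nat \<Rightarrow> nat \<Rightarrow> 'a \<Rightarrow> real" and u g :: "nat \<Rightarrow> 'a \<Rightarrow> real"
  assumes H: "\<And>i j. i < p \<Longrightarrow> j < p \<Longrightarrow> H i j \<in> borel_measurable M"
    and u: "\<And>j. j < p \<Longrightarrow> u j \<in> borel_measurable M"
    and g: "\<And>j. j < p \<Longrightarrow> g j \<in> borel_measurable M"
    and PH: "\<And>i j. i < p \<Longrightarrow> j < p \<Longrightarrow> prob {\<omega> \<in> space M. h \<le> \<bar>H i j \<omega>\<bar>} \<le> C * q"
    and Pu: "\<And>j. j < p \<Longrightarrow> prob {\<omega> \<in> space M. h \<le> \<bar>u j \<omega>\<bar>} \<le> C * q"
    and Pg: "\<And>j. j < p \<Longrightarrow> prob {\<omega> \<in> space M. t \<le> \<bar>g j \<omega>\<bar>} \<le> 2 * q"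
    and C: "0 \<le> C" "0 \<le> q"
  obtains E where "E \<in> events" and "1 - (real p)\<^sup>2 * (2 * C + 2) * q \<le> prob E"
    and "\<And>\<omega>. \<omega> \<in> E \<Longrightarrow> \<omega> \<in> space M \<and> (\<forall>i<p. \<forall>j<p. \<bar>H i j \<omega>\<bar> < h) \<and> (\<forall>j<p. \<bar>u j \<omega>\<bar> < h) \<and> (\<forall>j<p. \<bar>g j \<omega>\<bar> < t)"
proof -
  define BH where "BH = (\<Union>k\<in>{..<p} \<times> {..<p}. {\<omega> \<in> space M. h \<le> \<bar>H (fst k) (snd k) \<omega>\<bar>})"
  define Bu where "Bu = (\<Union>j\<in>{..<p}. {\<omega> \<in> space M. h \<le> \<bar>u j \<omega>\<bar>})"
  define Bg where "Bg = (\<Union>j\<in>{..<p}. {\<omega> \<in> space M. t \<le> \<bar>g j \<omega>\<bar>})"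
  have meas: "{\<omega> \<in> space M. a \<le> \<bar>f \<omega>\<bar>} \<in> events" if "f \<in> borel_measurable M" for f and a :: real
    using that by measurable
  have BH_ev: "BH \<in> events"
    unfolding BH_def by (intro sets.finite_UN meas H) auto
  have Bu_ev: "Bu \<in> events"
    unfolding Bu_def by (intro sets.finite_UN meas u) auto
  have Bg_ev: "Bg \<in> events"
    unfolding Bg_def by (intro sets.finite_UN meas g) auto
  note ev = BH_ev Bu_ev Bg_ev
  have "prob BH \<le> real (card ({..<p} \<times> {..<p})) * (C * q)"
    unfolding BH_def by (intro prob_finite_union_le meas H PH) auto
  then have BH: "prob BH \<le> (real p)\<^sup>2 * (C * q)" by (simp add: power2_eq_square)
  have p2: "real p \<le> (real p)\<^sup>2" by (simp add: power2_eq_square flip: of_nat_mult)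
  have "prob Bu \<le> real (card {..<p}) * (C * q)"
    unfolding Bu_def by (intro prob_finite_union_le meas u Pu) auto
  also have "\<dots> \<le> (real p)\<^sup>2 * (C * q)"
    using p2 C by (intro mult_right_mono) auto
  finally have Bu: "prob Bu \<le> (real p)\<^sup>2 * (C * q)" .
  have "prob Bg \<le> real (card {..<p}) * (2 * q)"
    unfolding Bg_def by (intro prob_finite_union_le meas g Pg) auto
  also have "\<dots> \<le> (real p)\<^sup>2 * (2 * q)"
    using p2 C by (intro mult_right_mono) auto
  finally have Bg: "prob Bg \<le> (real p)\<^sup>2 * (2 * q)" .
  define E where "E = space M - (BH \<union> Bu \<union> Bg)"
  have "prob (BH \<union> Bu \<union> Bg) \<le> prob (BH \<union> Bu) + prob Bg"
    using ev by (intro measure_Un_le) auto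
  also have "prob (BH \<union> Bu) \<le> prob BH + prob Bu"
    using ev by (intro measure_Un_le)
  finally have "prob (BH \<union> Bu \<union> Bg) \<le> (real p)\<^sup>2 * (2 * C + 2) * q"
    using BH Bu Bg by (simp add: algebra_simps)
  moreover have "prob E = 1 - prob (BH \<union> Bu \<union> Bg)"
    unfolding E_def using ev by (intro prob_compl) auto
  ultimately have ge: "1 - (real p)\<^sup>2 * (2 * C + 2) * q \<le> prob E" by simp
  have E_ev: "E \<in> events" using ev by (auto simp: E_def)
  have "\<omega> \<in> space M \<and> (\<forall>i<p. \<forall>j<p. \<bar>H i j \<omega>\<bar> < h) \<and> (\<forall>j<p. \<bar>u j \<omega>\<bar> < h) \<and> (\<forall>j<p. \<bar>g j \<omega>\<bar> < t)"
    if "\<omega> \<in> E" for \<omega>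
    using that unfolding E_def BH_def Bu_def Bg_def by (auto simp: not_le[symmetric])
  then show thesis using that E_ev ge by blast
qed

text \<open>The normalization of the columns makes the squared weights \<open>X\<^sub>i\<^sub>j / n\<close> sum up to \<open>1 / n\<close>.\<close>
lemma (in sparse_linear_model) noise_correlation_tail:
  assumes j: "j < p" and t: "0 < t" and v: "\<sigma>2 < v"
  shows "prob {\<omega> \<in> space M. t \<le> \<bar>\<Sum>i<n. X $$ (i, j) / real n * w i \<omega>\<bar>}
    \<le> 2 * exp (- (real n * t\<^sup>2 / (96 * v)))"
proof -
  have n: "0 < n" using normalized[OF j] by (cases n) auto
  have tail: "subgaussian_tail M (w i) \<sigma>2" if "i < n" for i
    using w_subgaussian[OF that] by (simp add: subgaussian_parameter_def)
  have v0: "0 < v" using tail[OF n] v by (simp add: subgaussian_tail_def)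
  have "(\<Sum>i<n. (X $$ (i, j) / real n)\<^sup>2) = (\<Sum>i<n. (X $$ (i, j))\<^sup>2) / (real n)\<^sup>2"
    by (simp add: power_divide sum_divide_distrib)
  also have "\<dots> = 1 / real n"
    using normalized[OF j] n by (simp add: field_simps power2_eq_square)
  finally have V: "(\<Sum>i<n. (X $$ (i, j) / real n)\<^sup>2) \<le> 1 / real n" by simp
  have mgf: "(\<integral>\<^sup>+\<omega>. ennreal (exp (\<theta> * w i \<omega>)) \<partial>M) \<le> ennreal (exp (24 * v * \<theta>\<^sup>2))"
    if "i \<in> {..<n}" for i \<theta>
    using that by (intro subgaussian_mgf[OF w_integrable w_mean tail v]) auto
  have "prob {\<omega> \<in> space M. t \<le> \<bar>\<Sum>i<n. X $$ (i, j) / real n * w i \<omega>\<bar>}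
      \<le> 2 * exp (- (t\<^sup>2 / (4 * (24 * v) * (1 / real n))))"
    using v0 n t V by (intro weighted_sum_tail[OF w_indep _ mgf]) auto
  then show ?thesis by (simp add: mult.commute)
qed

text \<open>The factor \<open>T\<close> equates rates: at level \<open>\<epsilon> * T\<close> the noise has the tail \<open>2 * exp (- c * n * \<epsilon>\<^sup>2 / z)\<close>, as
small as the tails that the closeness condition gives at level \<open>\<epsilon>\<close>. All three kinds of failure
are thus bounded by the weakest of these rates, the one with the factor \<open>s\<^sup>2\<close> in the denominator.\<close>
lemma (in sparse_linear_model) cocolasso_good_event:
  assumes \<Sigma>hat: "random_symmetric_mat M p \<Sigma>hat" and \<rho>til: "random_vec M p \<rho>til"
    and close: "closeness_condition M n p s (Sigma_mat X) (\<lambda>\<omega>. rho_vec X (response X \<beta> w \<omega>)) \<Sigma>hat \<rho>til C c z e0"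
    and C: "0 < C" and c: "0 < c" and \<epsilon>: "0 < \<epsilon>" "\<epsilon> \<le> e0" and v: "\<sigma>2 < v"
  defines "T \<equiv> sqrt (96 * c * v / z)"
  obtains E where "E \<in> events"
    and "1 - (real p)\<^sup>2 * (2 * C + 2) * exp (- (c * real n * \<epsilon>\<^sup>2 / ((real s)\<^sup>2 * z))) \<le> prob E"
    and "\<And>\<omega>. \<omega> \<in> E \<Longrightarrow> \<omega> \<in> space M"
    and "\<And>\<omega> i j. \<omega> \<in> E \<Longrightarrow> i < p \<Longrightarrow> j < p \<Longrightarrow> \<bar>\<Sigma>hat \<omega> $$ (i, j) - Sigma_mat X $$ (i, j)\<bar> \<le> \<epsilon>"
    and "\<And>\<omega> j. \<omega> \<in> E \<Longrightarrow> j < p \<Longrightarrow> \<bar>\<rho>til \<omega> $ j - (\<Sum>k<s. Sigma_mat X $$ (j, k) * \<beta> $ k)\<bar> \<le> \<epsilon> * (1 + T)"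
proof -
  define q where "q = exp (- (c * real n * \<epsilon>\<^sup>2 / ((real s)\<^sup>2 * z)))"
  define g where "g = (\<lambda>j \<omega>. \<Sum>i<n. X $$ (i, j) / real n * w i \<omega>)"
  have z: "0 < z" using close by (simp add: closeness_condition_def)
  have n: "0 < n" using normalized[of 0] s_pos s_le_p by (cases n) auto
  have "0 \<le> \<sigma>2" using w_subgaussian[OF n] by (simp add: subgaussian_parameter_def subgaussian_tail_def)
  then have v0: "0 < v" using v by simp
  have T: "0 < T" "T\<^sup>2 = 96 * c * v / z" using c v0 z by (auto simp: T_def)
  have s1: "1 \<le> (real s)\<^sup>2" using s_pos by simp
  have q_ge: "exp (- (c * real n * \<epsilon>\<^sup>2 / z)) \<le> q"
  proof -
    have "c * real n * \<epsilon>\<^sup>2 / ((real s)\<^sup>2 * z) \<le> c * real n * \<epsilon>\<^sup>2 / (1 * z)"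
      using s1 s_pos z c by (intro divide_left_mono mult_right_mono mult_pos_pos) auto
    then show ?thesis by (simp add: q_def)
  qed
  have [measurable]: "w i \<in> borel_measurable M" if "i < n" for i using w_integrable[OF that] by auto
  have g_meas: "g j \<in> borel_measurable M" for j
    unfolding g_def by measurable
  have supp: "\<beta> $ k = 0" if "k < p" "s \<le> k" for k using support[OF that(1)] that by simp
  have rho: "rho_vec X (response X \<beta> w \<omega>) $ j = (\<Sum>k<s. Sigma_mat X $$ (j, k) * \<beta> $ k) + g j \<omega>" if "j < p" for j \<omega>
    unfolding g_def by (rule rho_vec_response[OF X_carrier \<beta>_carrier s_le_p supp that])
  have PH: "prob {\<omega> \<in> space M. \<epsilon> \<le> \<bar>\<Sigma>hat \<omega> $$ (i, j) - Sigma_mat X $$ (i, j)\<bar>} \<le> C * q" if "i < p" "j < p" for i j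
  proof -
    have "prob {\<omega> \<in> space M. \<epsilon> \<le> \<bar>\<Sigma>hat \<omega> $$ (i, j) - Sigma_mat X $$ (i, j)\<bar>} \<le> C * exp (- (c * real n * \<epsilon>\<^sup>2 / z))"
      using close \<epsilon> that by (auto simp: closeness_condition_def)
    also have "\<dots> \<le> C * q" using q_ge C by (intro mult_left_mono) auto
    finally show ?thesis .
  qed
  have Pu: "prob {\<omega> \<in> space M. \<epsilon> \<le> \<bar>\<rho>til \<omega> $ j - rho_vec X (response X \<beta> w \<omega>) $ j\<bar>} \<le> C * q" if "j < p" for j
    using close \<epsilon> that by (auto simp: closeness_condition_def q_def)
  have Pg: "prob {\<omega> \<in> space M. \<epsilon> * T \<le> \<bar>g j \<omega>\<bar>} \<le> 2 * q" if "j < p" for j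
  proof -
    have "prob {\<omega> \<in> space M. \<epsilon> * T \<le> \<bar>g j \<omega>\<bar>} \<le> 2 * exp (- (real n * (\<epsilon> * T)\<^sup>2 / (96 * v)))"
      unfolding g_def using \<epsilon> T by (intro noise_correlation_tail[OF that _ v]) auto
    also have "real n * (\<epsilon> * T)\<^sup>2 / (96 * v) = c * real n * \<epsilon>\<^sup>2 / z"
      using v0 z by (simp add: power_mult_distrib T(2) field_simps)
    also have "2 * exp (- (c * real n * \<epsilon>\<^sup>2 / z)) \<le> 2 * q" using q_ge by simp
    finally show ?thesis .
  qed
  have H_meas: "(\<lambda>\<omega>. \<Sigma>hat \<omega> $$ (i, j) - Sigma_mat X $$ (i, j)) \<in> borel_measurable M" if "i < p" "j < p" for i j
    using \<Sigma>hat that by (intro borel_measurable_diff) (auto simp: random_symmetric_mat_def)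
  have u_meas: "(\<lambda>\<omega>. \<rho>til \<omega> $ j - rho_vec X (response X \<beta> w \<omega>) $ j) \<in> borel_measurable M" if "j < p" for j
    using \<rho>til that g_meas[of j]
    by (auto simp: random_vec_def rho intro!: borel_measurable_diff borel_measurable_add)
  obtain E where E: "E \<in> events" "1 - (real p)\<^sup>2 * (2 * C + 2) * q \<le> prob E"
    and good: "\<And>\<omega>. \<omega> \<in> E \<Longrightarrow> \<omega> \<in> space M \<and> (\<forall>i<p. \<forall>j<p. \<bar>\<Sigma>hat \<omega> $$ (i, j) - Sigma_mat X $$ (i, j)\<bar> < \<epsilon>)
      \<and> (\<forall>j<p. \<bar>\<rho>til \<omega> $ j - rho_vec X (response X \<beta> w \<omega>) $ j\<bar> < \<epsilon>) \<and> (\<forall>j<p. \<bar>g j \<omega>\<bar> < \<epsilon> * T)"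
  proof (rule prob_all_small_ge[where H = "\<lambda>i j \<omega>. \<Sigma>hat \<omega> $$ (i, j) - Sigma_mat X $$ (i, j)"
      and u = "\<lambda>j \<omega>. \<rho>til \<omega> $ j - rho_vec X (response X \<beta> w \<omega>) $ j" and g = g and p = p and h = \<epsilon> and t = "\<epsilon> * T"
      and C = C and q = q])
  qed (use H_meas u_meas g_meas PH Pu Pg C in \<open>auto simp: q_def\<close>)
  show thesis
  proof (rule that[OF E(1) E(2)[unfolded q_def]])
    fix \<omega> j assume "\<omega> \<in> E" "j < p"
    then have "\<bar>\<rho>til \<omega> $ j - ((\<Sum>k<s. Sigma_mat X $$ (j, k) * \<beta> $ k) + g j \<omega>)\<bar> < \<epsilon>" "\<bar>g j \<omega>\<bar> < \<epsilon> * T"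
      using good[of \<omega>] by (auto simp: rho)
    then show "\<bar>\<rho>til \<omega> $ j - (\<Sum>k<s. Sigma_mat X $$ (j, k) * \<beta> $ k)\<bar> \<le> \<epsilon> * (1 + T)"
      by (simp add: distrib_left)
  qed (use good in \<open>auto intro: less_imp_le\<close>)
qed

text \<open>Since the projection doubles \<open>\<epsilon>\<close>, the constant \<open>32\<close> replaces the \<open>16\<close> of the deterministic
argument, and the \<open>l\<^sub>1\<close> norm of \<open>\<beta>\<close> enters with the factor two.\<close>
lemma (in sparse_linear_model) cocolasso_recovery:
  fixes C c z \<eta> \<gamma> l \<epsilon> v q :: real
  defines "\<Sigma> \<equiv> Sigma_mat X"
  defines "K \<equiv> submatrix \<Sigma> {..<s} {..<s}"
  defines "B \<equiv> the (mat_inverse K)"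
  defines "\<kappa> \<equiv> 4 * mat_inf_norm B + min_eigenvalue K powr (- 1 / 2)"
  assumes \<Sigma>hat: "random_symmetric_mat M p \<Sigma>hat" and \<rho>til: "random_vec M p \<rho>til"
    and close: "closeness_condition M n p s \<Sigma> (\<lambda>\<omega>. rho_vec X (response X \<beta> w \<omega>)) \<Sigma>hat \<rho>til C c z \<eta>"
    and near: "\<forall>\<omega>\<in>space M. nearest_psd p (\<Sigma>hat \<omega>) (\<Sigma>til \<omega>)"
    and irrep: "mat_inf_norm (submatrix \<Sigma> {s..<p} {..<s} * B) = 1 - \<gamma>" and \<gamma>: "0 < \<gamma>"
    and eig: "0 < min_eigenvalue K"
    and C: "0 < C" and c: "0 < c" and \<epsilon>: "0 < \<epsilon>" "\<epsilon> \<le> \<eta>" and l: "0 < l" and v: "\<sigma>2 < v"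
    and small: "32 * \<epsilon> * real s * mat_inf_norm B \<le> \<gamma>"
    and noise: "\<epsilon> * (1 + sqrt (96 * c * v / z) + 2 * vec_l1_norm (vec_first \<beta> s)) \<le> \<gamma> * l / 8"
    and q: "q \<le> 1 - (real p)\<^sup>2 * (2 * C + 2) * exp (- (c * real n * \<epsilon>\<^sup>2 / ((real s)\<^sup>2 * z)))"
  shows "with_prob_at_least M q (\<lambda>\<omega>.
    (\<exists>!b. cocolasso_minimizer p (\<Sigma>til \<omega>) (\<rho>til \<omega>) l b) \<and>
    (\<forall>b. cocolasso_minimizer p (\<Sigma>til \<omega>) (\<rho>til \<omega>) l b \<longrightarrow>
      (\<forall>j<p. b $ j \<noteq> 0 \<longrightarrow> j < s) \<and>
      vec_inf_norm (vec_first b s - vec_first \<beta> s) \<le> \<kappa> * l \<and>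
      (Min ((\<lambda>j. \<bar>\<beta> $ j\<bar>) ` {..<s}) \<ge> \<kappa> * l \<longrightarrow> (\<forall>j<s. sgn (b $ j) = sgn (\<beta> $ j)))))"
proof -
  have S: "\<Sigma> \<in> carrier_mat p p" and S_psd: "psd_mat p \<Sigma>"
    unfolding \<Sigma>_def by (rule Sigma_mat_carrier[OF X_carrier], rule Sigma_mat_psd[OF X_carrier])
  obtain E where E: "E \<in> events"
      "1 - (real p)\<^sup>2 * (2 * C + 2) * exp (- (c * real n * \<epsilon>\<^sup>2 / ((real s)\<^sup>2 * z))) \<le> prob E"
    and E_space: "\<And>\<omega>. \<omega> \<in> E \<Longrightarrow> \<omega> \<in> space M"
    and E_\<Sigma>: "\<And>\<omega> i j. \<omega> \<in> E \<Longrightarrow> i < p \<Longrightarrow> j < p \<Longrightarrow> \<bar>\<Sigma>hat \<omega> $$ (i, j) - \<Sigma> $$ (i, j)\<bar> \<le> \<epsilon>"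
    and E_\<rho>: "\<And>\<omega> j. \<omega> \<in> E \<Longrightarrow> j < p \<Longrightarrow>
      \<bar>\<rho>til \<omega> $ j - (\<Sum>k<s. \<Sigma> $$ (j, k) * \<beta> $ k)\<bar> \<le> \<epsilon> * (1 + sqrt (96 * c * v / z))"
    using cocolasso_good_event[OF \<Sigma>hat \<rho>til close[unfolded \<Sigma>_def] C c \<epsilon> v, folded \<Sigma>_def] by blast
  show ?thesis
    unfolding with_prob_at_least_def
  proof (intro bexI[of _ E] conjI[of "q \<le> prob E"] ballI)
    show "E \<in> events" by (rule E)
    show "q \<le> prob E" using q E(2) by linarith
    fix \<omega> assume \<omega>: "\<omega> \<in> E"
    have near\<omega>: "nearest_psd p (\<Sigma>hat \<omega>) (\<Sigma>til \<omega>)" using near E_space[OF \<omega>] by blast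
    then have psd: "psd_mat p (\<Sigma>til \<omega>)" by (simp add: nearest_psd_def is_arg_min_def)
    have carr: "\<Sigma>hat \<omega> \<in> carrier_mat p p" using \<Sigma>hat E_space[OF \<omega>] by (simp add: random_symmetric_mat_def)
    have dist: "\<bar>\<Sigma>til \<omega> $$ (i, j) - \<Sigma> $$ (i, j)\<bar> \<le> 2 * \<epsilon>" if "i < p" "j < p" for i j
      using nearest_psd_entry_le[OF near\<omega> S_psd carr E_\<Sigma>[OF \<omega>] _ that] \<epsilon> by simp
    show "(\<exists>!b. cocolasso_minimizer p (\<Sigma>til \<omega>) (\<rho>til \<omega>) l b) \<and>
      (\<forall>b. cocolasso_minimizer p (\<Sigma>til \<omega>) (\<rho>til \<omega>) l b \<longrightarrow>
        (\<forall>j<p. b $ j \<noteq> 0 \<longrightarrow> j < s) \<and>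
        vec_inf_norm (vec_first b s - vec_first \<beta> s) \<le> \<kappa> * l \<and>
        (Min ((\<lambda>j. \<bar>\<beta> $ j\<bar>) ` {..<s}) \<ge> \<kappa> * l \<longrightarrow> (\<forall>j<s. sgn (b $ j) = sgn (\<beta> $ j))))"
      unfolding \<kappa>_def B_def K_def
    proof (rule cocolasso_recovery_if_close[where \<gamma> = \<gamma> and d = "2 * \<epsilon>" and e = "\<epsilon> * (1 + sqrt (96 * c * v / z))"])
      show "16 * (2 * \<epsilon>) * real s * mat_inf_norm (the (mat_inverse (submatrix \<Sigma> {..<s} {..<s}))) \<le> \<gamma>"
        using small by (simp add: B_def K_def)
      show "\<epsilon> * (1 + sqrt (96 * c * v / z)) + 2 * \<epsilon> * vec_l1_norm (vec_first \<beta> s) \<le> \<gamma> * l / 8"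
        using noise by (simp add: algebra_simps)
    qed (use S s_le_p s_pos irrep \<gamma> eig psd dist \<beta>_carrier E_\<rho>[OF \<omega>] l in \<open>simp_all add: B_def K_def\<close>)
  qed
qed

section \<open>Sign recovery with high probability\<close>

theorem theorem2:
  fixes C c :: real
  assumes "0 < C" and "0 < c"
  shows "\<exists>C'>0. \<exists>c'>0. \<forall>(\<zeta> :: real vec \<Rightarrow> 'th \<Rightarrow> real \<Rightarrow> real) (\<epsilon>0 :: real vec \<Rightarrow> 'th \<Rightarrow> real \<Rightarrow> real) (\<gamma> :: real).
    0 < \<gamma> \<longrightarrow>
    (\<exists>\<epsilon>1 \<epsilon>2 \<epsilon>3 :: real mat \<Rightarrow> real vec \<Rightarrow> 'th \<Rightarrow> real \<Rightarrow> real.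
      (\<forall>K b \<theta> v. 0 < \<epsilon>1 K b \<theta> v \<and> 0 < \<epsilon>2 K b \<theta> v \<and> 0 < \<epsilon>3 K b \<theta> v) \<and>
      (\<forall>(M :: 'w measure) n p s X \<beta> w \<sigma>2 \<theta> \<Sigma>hat \<Sigma>til \<rho>til l \<epsilon>.
        let \<Sigma> = Sigma_mat X;
            \<Sigma>SS = submatrix \<Sigma> {..<s} {..<s};
            \<Sigma>SS_inv = the (mat_inverse \<Sigma>SS);
            \<beta>S = vec_first \<beta> s;
            z = \<zeta> \<beta>S \<theta> \<sigma>2;
            e0 = \<epsilon>0 \<beta>S \<theta> \<sigma>2;
            e1 = \<epsilon>1 \<Sigma>SS \<beta>S \<theta> \<sigma>2;
            e2 = \<epsilon>2 \<Sigma>SS \<beta>S \<theta> \<sigma>2;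
            e3 = \<epsilon>3 \<Sigma>SS \<beta>S \<theta> \<sigma>2;
            Cmin = min_eigenvalue \<Sigma>SS;
            \<kappa> = 4 * mat_inf_norm \<Sigma>SS_inv + Cmin powr (- 1 / 2);
            \<delta>1 = (real p)\<^sup>2 * C' * exp (- (c' * real n * \<gamma>\<^sup>2 * l\<^sup>2 / ((real s)\<^sup>2 * z)))
               + (real p)\<^sup>2 * C' * exp (- (c' * real n * \<epsilon>\<^sup>2 / ((real s)\<^sup>2 * z)))
        in
          sparse_linear_model M n p s X \<beta> w \<sigma>2 \<longrightarrow>
          random_symmetric_mat M p \<Sigma>hat \<longrightarrow>
          random_vec M p \<rho>til \<longrightarrow>
          closeness_condition M n p s \<Sigma> (\<lambda>\<omega>. rho_vec X (response X \<beta> w \<omega>)) \<Sigma>hat \<rho>til C c z e0 \<longrightarrow>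
          (\<forall>\<omega>\<in>space M. nearest_psd p (\<Sigma>hat \<omega>) (\<Sigma>til \<omega>)) \<longrightarrow>
          mat_inf_norm (submatrix \<Sigma> {s..<p} {..<s} * \<Sigma>SS_inv) = 1 - \<gamma> \<longrightarrow>
          0 < Cmin \<longrightarrow>
          0 < l \<longrightarrow> l \<le> min e0 (4 * e0 / \<gamma>) \<longrightarrow>
          0 < \<epsilon> \<longrightarrow> \<epsilon> \<le> min e1 (l / (l * e2 + e3)) \<longrightarrow>
          with_prob_at_least M (1 - \<delta>1) (\<lambda>\<omega>.
            (\<exists>!b. cocolasso_minimizer p (\<Sigma>til \<omega>) (\<rho>til \<omega>) l b) \<and>
            (\<forall>b. cocolasso_minimizer p (\<Sigma>til \<omega>) (\<rho>til \<omega>) l b \<longrightarrow>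
              (\<forall>j<p. b $ j \<noteq> 0 \<longrightarrow> j < s) \<and>
              vec_inf_norm (vec_first b s - \<beta>S) \<le> \<kappa> * l \<and>
              (Min ((\<lambda>j. \<bar>\<beta> $ j\<bar>) ` {..<s}) \<ge> \<kappa> * l \<longrightarrow> (\<forall>j<s. sgn (b $ j) = sgn (\<beta> $ j)))))))"
proof (rule exI[of _ "2 * C + 2"], rule conjI, goal_cases)
  case 1
  show ?case using \<open>0 < C\<close> by simp
next
  case 2
  show ?case
  proof (rule exI[of _ c], rule conjI, goal_cases)
    case 1
    show ?case by (rule \<open>0 < c\<close>)
  next
    case 2
    show ?case
    proof (intro allI impI, goal_cases)
      case (1 \<zeta> \<epsilon>0 \<gamma>)
      define N where "N = (\<lambda>K. mat_inf_norm (the (mat_inverse K)))"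
      \<comment> \<open>Adding \<open>1\<close> to \<open>\<sigma>2\<close> covers noise that vanishes almost surely.\<close>
      define T where "T = (\<lambda>z v. sqrt (96 * c * (\<bar>v\<bar> + 1) / \<bar>z :: real\<bar>))"
      \<comment> \<open>The first entry of the minimum keeps \<open>\<epsilon>\<close> in the range of the closeness condition, the second makes the
        perturbation of \<open>\<Sigma>\<close> harmless. The default \<open>1\<close> only serves positivity at arguments where \<open>\<epsilon>0\<close> is not positive.\<close>
      define \<epsilon>1 where "\<epsilon>1 = (\<lambda>K b \<theta> v. min (if 0 < \<epsilon>0 b \<theta> v then \<epsilon>0 b \<theta> v else 1)
        (\<gamma> / (32 * (real (dim_row K) + 1) * (N K + 1))))"
      define \<epsilon>2 where "\<epsilon>2 = (\<lambda>(K :: real mat) (b :: real vec) (\<theta> :: 'th) (v :: real). 1 :: real)"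
      \<comment> \<open>Since \<open>\<epsilon> * \<epsilon>3 \<le> l\<close>, the errors of order \<open>\<epsilon>\<close>, including the noise at level \<open>\<epsilon> * T\<close>, stay below \<open>\<gamma> * l / 8\<close>.\<close>
      define \<epsilon>3 where "\<epsilon>3 = (\<lambda>(K :: real mat) b \<theta> v. 8 * (1 + T (\<zeta> b \<theta> v) v + 2 * vec_l1_norm b) / \<gamma>)"
      have T0: "0 \<le> T z v" for z v using \<open>0 < c\<close> by (simp add: T_def)
      have N0: "0 \<le> N K" for K by (simp add: N_def mat_inf_norm_nonneg)
      have l1_0: "0 \<le> vec_l1_norm b" for b by (simp add: vec_l1_norm_def sum_nonneg)
      have \<epsilon>1_pos: "0 < \<epsilon>1 K b \<theta> v" for K b \<theta> v
        using 1 N0[of K] by (auto simp: \<epsilon>1_def intro!: divide_pos_pos mult_pos_pos add_nonneg_pos)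
      have \<epsilon>3_pos: "0 < \<epsilon>3 K b \<theta> v" for K b \<theta> v
        using 1 T0[of "\<zeta> b \<theta> v" v] l1_0[of b] by (auto simp: \<epsilon>3_def intro!: divide_pos_pos)
      show ?case
      proof (rule exI[of _ \<epsilon>1], rule exI[of _ \<epsilon>2], rule exI[of _ \<epsilon>3], rule conjI, goal_cases)
        case 1
        show ?case using \<epsilon>1_pos \<epsilon>3_pos by (simp add: \<epsilon>2_def)
      next
        case 2
        show ?case
          unfolding Let_def
        proof (intro allI impI, goal_cases)
          case (1 M n p s X \<beta> w \<sigma>2 \<theta> \<Sigma>hat \<Sigma>til \<rho>til l \<epsilon>)
          note hyps = 1
          interpret sparse_linear_model M n p s X \<beta> w \<sigma>2 by (rule hyps(1))
          define K where "K = submatrix (Sigma_mat X) {..<s} {..<s}"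
          define b where "b = vec_first \<beta> s"
          define z where "z = \<zeta> b \<theta> \<sigma>2"
          define e0 where "e0 = \<epsilon>0 b \<theta> \<sigma>2"
          note h = hyps[folded K_def b_def, folded z_def e0_def]
          have z: "0 < z" and e0: "0 < e0" using h(4) by (auto simp: closeness_condition_def)
          have dim: "dim_row K = s"
            using submatrix_leading[OF Sigma_mat_carrier[OF X_carrier] s_le_p] by (simp add: K_def)
          have \<epsilon>_e0: "\<epsilon> \<le> e0" and \<epsilon>_N: "\<epsilon> \<le> \<gamma> / (32 * (real s + 1) * (N K + 1))"
            and \<epsilon>_l: "\<epsilon> \<le> l / (l + \<epsilon>3 K b \<theta> \<sigma>2)"
            using h(11) e0 by (auto simp: \<epsilon>1_def \<epsilon>2_def dim e0_def)
          have "32 * \<epsilon> * real s * N K \<le> \<epsilon> * (32 * (real s + 1) * (N K + 1))"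
            using h(10) N0[of K] by (simp add: algebra_simps)
          also have "\<dots> \<le> \<gamma>"
            using \<epsilon>_N N0[of K] by (subst (asm) pos_le_divide_eq) (auto intro!: mult_pos_pos)
          finally have small: "32 * \<epsilon> * real s * N K \<le> \<gamma>" .
          have "\<epsilon> * \<epsilon>3 K b \<theta> \<sigma>2 \<le> \<epsilon> * (l + \<epsilon>3 K b \<theta> \<sigma>2)"
            using h(8,10) by simp
          also have "\<dots> \<le> l"
            using \<epsilon>_l h(8) \<epsilon>3_pos[of K b \<theta> \<sigma>2] by (subst (asm) pos_le_divide_eq) auto
          finally have "\<epsilon> * \<epsilon>3 K b \<theta> \<sigma>2 \<le> l" .
          then have "\<gamma> / 8 * (\<epsilon> * \<epsilon>3 K b \<theta> \<sigma>2) \<le> \<gamma> / 8 * l"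
            using \<open>0 < \<gamma>\<close> by (intro mult_left_mono) auto
          moreover have "\<gamma> / 8 * (\<epsilon> * \<epsilon>3 K b \<theta> \<sigma>2) = \<epsilon> * (1 + T z \<sigma>2 + 2 * vec_l1_norm b)"
            using \<open>0 < \<gamma>\<close> by (simp add: \<epsilon>3_def z_def field_simps)
          ultimately have "\<epsilon> * (1 + T z \<sigma>2 + 2 * vec_l1_norm b) \<le> \<gamma> * l / 8" by linarith
          moreover have "T z \<sigma>2 = sqrt (96 * c * (\<bar>\<sigma>2\<bar> + 1) / z)" using z by (simp add: T_def)
          ultimately have noise: "\<epsilon> * (1 + sqrt (96 * c * (\<bar>\<sigma>2\<bar> + 1) / z) + 2 * vec_l1_norm b) \<le> \<gamma> * l / 8"
            by simp
          have q: "1 - (A + (real p)\<^sup>2 * (2 * C + 2) * exp (- (c * real n * \<epsilon>\<^sup>2 / ((real s)\<^sup>2 * z))))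
              \<le> 1 - (real p)\<^sup>2 * (2 * C + 2) * exp (- (c * real n * \<epsilon>\<^sup>2 / ((real s)\<^sup>2 * z)))" if "0 \<le> A" for A
            using that by simp
          show ?case
            by (rule cocolasso_recovery[OF hyps(2-6) \<open>0 < \<gamma>\<close> hyps(7) \<open>0 < C\<close> \<open>0 < c\<close> hyps(10)
                  \<epsilon>_e0[unfolded e0_def b_def] hyps(8) _ small[unfolded N_def K_def]
                  noise[unfolded z_def b_def] q[unfolded z_def b_def]])
              (use \<open>0 < C\<close> in auto)
        qed
      qed
    qed
  qed
qed

end
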